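(* If $H$ is any Halin graph, then $b_v(H)\le 1$. This bound is tight, i.e. there exists a Halin graph $H$ with $b_v(H)=1$.
   Context: All graphs are finite and simple. A Halin graph is a simple planar graph $G=T\cup C$ with no vertex of degree $2$, where $T$ is a tree and $C$ is a simple cycle (on at least three vertices) whose vertex set is exactly the set of all leaves of $T$ ($C$ is induced by the leaves of $T$). For an integer $k\ge 0$, a $k$-bend path is a piecewise linear simple curve in the plane made up of $k+1$ line segments, each of which is horizontal or vertical, with consecutive segments being of different orientation. A $B_k$-VPG representation of a graph $G$ is a collection of $k$-bend paths $\{P_u\}_{u\in V(G)}$ such that for distinct $u,v\in V(G)$, $uv\in E(G)$ if and only if $P_u$ and $P_v$ have at least one point in common. The VPG bend-number $b_v(G)$ is the minimum $k$ such that $G$ has a $B_k$-VPG representation. *)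

theory Defs
  imports
    "HOL-Analysis.Analysis"
    "HOL-Library.Extended_Nat"
    "Graph_Theory.Digraph_Component"
begin

text \<open>
  Finite simple graphs are \<^locale>\<open>pair_graph\<close>s: every edge is stored as two opposite arcs, so
  \<^const>\<open>out_degree\<close> is the usual degree.  The plane is \<^typ>\<open>complex\<close>.
\<close>

section \<open>Halin graphs\<close>

text \<open>
  The library predicate \<open>tree\<close> is about directed cycles, and the two opposite arcs of an edge form
  a directed cycle of length 2; the cycles of the undirected graph are those of length at least 3.
  \<open>connected\<close> is qualified because the topological predicate has the same base name.
\<close>

definition tree_graph :: "'a pair_pre_digraph \<Rightarrow> bool" where
  "tree_graph T \<longleftrightarrow> pair_graph T \<and> Digraph_Component.connected (with_proj T) \<and>
     \<not> (\<exists>p. pre_digraph.cycle (with_proj T) p \<and> 3 \<le> length p)"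

definition cycle_graph :: "'a pair_pre_digraph \<Rightarrow> bool" where
  "cycle_graph C \<longleftrightarrow> pair_graph C \<and>
     (\<exists>p. pre_digraph.cycle (with_proj C) p \<and> 3 \<le> length p \<and>
          pverts C = fst ` set p \<and> parcs C = set p \<union> (set p)\<inverse>)"

definition leaves :: "'a pair_pre_digraph \<Rightarrow> 'a set" where
  "leaves T = {v \<in> pverts T. out_degree (with_proj T) v = 1}"

definition edges :: "'a pair_pre_digraph \<Rightarrow> 'a set set" where
  "edges G = {{u, v} | u v. (u, v) \<in> parcs G}"

definition plane_drawing ::
    "'a pair_pre_digraph \<Rightarrow> ('a \<Rightarrow> complex) \<Rightarrow> ('a set \<Rightarrow> real \<Rightarrow> complex) \<Rightarrow> bool" where
  "plane_drawing G f \<gamma> \<longleftrightarrow>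
     inj_on f (pverts G) \<and>
     (\<forall>e\<in>edges G. arc (\<gamma> e) \<and> {pathstart (\<gamma> e), pathfinish (\<gamma> e)} = f ` e \<and>
        path_image (\<gamma> e) \<inter> f ` pverts G = f ` e) \<and>
     (\<forall>e\<in>edges G. \<forall>e'\<in>edges G. e \<noteq> e' \<longrightarrow>
        path_image (\<gamma> e) \<inter> path_image (\<gamma> e') \<subseteq> f ` (e \<inter> e'))"

definition planar_graph :: "'a pair_pre_digraph \<Rightarrow> bool" where
  "planar_graph G \<longleftrightarrow> (\<exists>f \<gamma>. plane_drawing G f \<gamma>)"

definition halin_graph :: "'a pair_pre_digraph \<Rightarrow> bool" where
  "halin_graph G \<longleftrightarrow> pair_graph G \<and> planar_graph G \<and>
     (\<forall>v\<in>pverts G. out_degree (with_proj G) v \<noteq> 2) \<and>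
     (\<exists>T C. tree_graph T \<and> cycle_graph C \<and> pverts C = leaves T \<and>
        pverts G = pverts T \<union> pverts C \<and> parcs G = parcs T \<union> parcs C)"

section \<open>Bend paths and the VPG bend-number\<close>

definition horizontal :: "complex \<Rightarrow> complex \<Rightarrow> bool" where
  "horizontal p q \<longleftrightarrow> p \<noteq> q \<and> Im p = Im q"

definition vertical :: "complex \<Rightarrow> complex \<Rightarrow> bool" where
  "vertical p q \<longleftrightarrow> p \<noteq> q \<and> Re p = Re q"

fun polyline :: "complex list \<Rightarrow> real \<Rightarrow> complex" where
  "polyline [] = linepath 0 0"
| "polyline [p] = linepath p p"
| "polyline [p, q] = linepath p q"
| "polyline (p # q # r # ps) = linepath p q +++ polyline (q # r # ps)"

text \<open>
  The list \<open>ps\<close> consists of the two endpoints and the \<open>k\<close> bends; \<^const>\<open>arc\<close> says that the curve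
  is simple.
\<close>

definition bend_path :: "nat \<Rightarrow> (real \<Rightarrow> complex) \<Rightarrow> bool" where
  "bend_path k g \<longleftrightarrow> (\<exists>ps. length ps = k + 2 \<and>
     (\<forall>i\<le>k. horizontal (ps ! i) (ps ! Suc i) \<or> vertical (ps ! i) (ps ! Suc i)) \<and>
     (\<forall>i<k. horizontal (ps ! i) (ps ! Suc i) \<longleftrightarrow> vertical (ps ! Suc i) (ps ! Suc (Suc i))) \<and>
     g = polyline ps \<and> arc g)"

definition vpg_representation ::
    "nat \<Rightarrow> 'a pair_pre_digraph \<Rightarrow> ('a \<Rightarrow> real \<Rightarrow> complex) \<Rightarrow> bool" where
  "vpg_representation k G P \<longleftrightarrow>
     (\<forall>u\<in>pverts G. bend_path k (P u)) \<and>
     (\<forall>u\<in>pverts G. \<forall>v\<in>pverts G. u \<noteq> v \<longrightarrow>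
        ((u, v) \<in> parcs G \<longleftrightarrow> path_image (P u) \<inter> path_image (P v) \<noteq> {}))"

text \<open>
  The value is \<open>\<infinity>\<close> if there is no representation at all; as \<^typ>\<open>enat\<close> is well-ordered, the infimum
  is otherwise a minimum.
\<close>

definition vpg_bend_number :: "'a pair_pre_digraph \<Rightarrow> enat" where
  "vpg_bend_number G = Inf {enat k | k. \<exists>P. vpg_representation k G P}"

end

theory Submission
  imports Defs
begin

text \<open>
  Root the tree of a Halin graph at a leaf and number the other leaves along the cycle.  The leaves
  below any vertex form an interval: if the leaf \<open>i\<close> were missing between \<open>a\<close> and \<open>b\<close>, the tree paths
  joining \<open>a\<close> to \<open>b\<close> and \<open>i\<close> to the root would be disjoint, while their ends alternate on the cycle;
  together with a connection between them inside the tree this is a plane drawing of a subdivision of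
  \<open>K\<^sub>3\<^sub>,\<^sub>3\<close>, which the theta-curve theorem excludes.  Given the intervals, every vertex is drawn as
  an L: vertically at the left end of its interval, horizontally at the height given by its depth.

  The bound is attained by the wheel with four spokes: the neighbours of a vertex represented by a
  segment form an interval graph, and a 4-cycle is not one.
\<close>

section \<open>Crossing a theta curve\<close>

text \<open>Planarity is given as a topological drawing, with no faces or rotation system at hand,
  and the tree may be drawn on either side of the cycle. So the interval property is reduced to a
  statement about a single closed curve. The three tree paths from the leaves \<open>a\<close>,
  \<open>i\<close>, \<open>b\<close> to the root, stripped of their ends, miss the cycle and all
  pass through the only child \<open>t\<close> of the root; their union is connected and hence lies
  on one side. Rooting at a leaf serves twice: the root is the fourth point of the alternation, and
  cutting the cycle there turns circular arcs of leaves into intervals of indices. Depth can serve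
  as height because different vertices of the same depth have disjoint intervals, while a leg of
  length one hanging down from a vertex ends on the line of its parent. The edges of the cycle are
  the harder part, since a leaf must also reach its neighbours on the cycle. Every inner vertex
  whose interval contains a leaf has smaller depth than the leaf, so nothing blocks the leaf from
  rising to a height \<open>B\<close> above all depths, where these contacts take place.\<close>

text \<open>The chord \<open>p\<close> splits the inside into two regions, and the connected set
  \<open>Q\<close> stays in one of them. The closure of the region bounded by \<open>c2\<close> and
  \<open>p\<close> contains no point of \<open>c1\<close> besides \<open>a\<close> and
  \<open>b\<close>, so from there \<open>Q\<close> cannot reach \<open>i\<close>; likewise the other
  region is cut off from \<open>j\<close>.\<close>

lemma theta_inside_no_crossing:
  fixes c1 c2 p :: "real \<Rightarrow> complex"
  assumes arcs: "arc c1" "arc c2" "arc p"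
    and c1: "pathstart c1 = a" "pathfinish c1 = b"
    and c2: "pathstart c2 = a" "pathfinish c2 = b"
    and p: "pathstart p = a" "pathfinish p = b"
    and c12: "path_image c1 \<inter> path_image c2 = {a, b}"
    and c1p: "path_image c1 \<inter> path_image p = {a, b}"
    and c2p: "path_image c2 \<inter> path_image p = {a, b}"
    and i: "i \<in> path_image c1 - {a, b}" and j: "j \<in> path_image c2 - {a, b}"
    and Q: "topological_space_class.connected Q" "Q \<inter> path_image p = {}"
      "Q \<subseteq> inside (path_image c1 \<union> path_image c2)" "i \<in> closure Q" "j \<in> closure Q"
    and p_in: "path_image p \<inter> inside (path_image c1 \<union> path_image c2) \<noteq> {}"
  shows False
proof -
  let ?C1 = "path_image c1" and ?C2 = "path_image c2" and ?P = "path_image p"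
  have "a \<noteq> b" using arcs(1) c1 arc_distinct_ends by blast
  then obtain disj: "inside (?C1 \<union> ?P) \<inter> inside (?C2 \<union> ?P) = {}"
    and un: "inside (?C1 \<union> ?P) \<union> inside (?C2 \<union> ?P) \<union> (?P - {a, b}) = inside (?C1 \<union> ?C2)"
    using split_inside_simple_closed_curve[of c1 a b c2 p] arcs arc_imp_simple_path c1 c2 p
      c12 c1p c2p p_in by metis
  have closed: "closed ?C1" "closed ?C2" "closed ?P"
    using arcs by (auto intro: closed_arc_image)
  have op: "open (inside (?C1 \<union> ?P))" "open (inside (?C2 \<union> ?P))"
    using closed by (auto intro: open_inside)
  have cover: "Q \<subseteq> inside (?C1 \<union> ?P) \<union> inside (?C2 \<union> ?P)"
    using Q(2,3) un by blast
  have no: "inside (?C1 \<union> ?C2) \<inter> (?C1 \<union> ?C2) = {}"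
    by (simp add: inside_no_overlap)
  have "Q \<inter> inside (?C1 \<union> ?P) = {} \<or> Q \<inter> inside (?C2 \<union> ?P) = {}"
    using connectedD[OF Q(1) op] disj cover by blast
  then consider "Q \<subseteq> inside (?C2 \<union> ?P)" | "Q \<subseteq> inside (?C1 \<union> ?P)"
    using cover by blast
  then show False
  proof cases
    case 1
    then have "i \<in> closure (inside (?C2 \<union> ?P))" using Q(4) closure_mono by blast
    then have "i \<in> ?C2 \<union> ?P \<union> inside (?C2 \<union> ?P)"
      using closure_inside_subset[of "?C2 \<union> ?P"] closed by auto
    then show False using i un no c12 c1p by blast
  next
    case 2
    then have "j \<in> closure (inside (?C1 \<union> ?P))" using Q(5) closure_mono by blast
    then have "j \<in> ?C1 \<union> ?P \<union> inside (?C1 \<union> ?P)"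
      using closure_inside_subset[of "?C1 \<union> ?P"] closed by auto
    then show False using j un no c12 c2p by blast
  qed
qed

text \<open>The image of the inside without \<open>w\<close> is connected and, because of the points
  near \<open>w\<close>, unbounded; so it lies outside the image curve. The inside of the image
  curve is nonempty, and what is left to fill it is the image of the outside together with 0, the
  image of infinity. This set is connected too.\<close>

lemma inversion_outside_subset_inside:
  fixes c :: "real \<Rightarrow> complex"
  assumes c: "simple_path c" "pathfinish c = pathstart c"
    and w: "w \<in> inside (path_image c)"
  defines "f \<equiv> \<lambda>z. inverse (z - w)"
  shows "f ` outside (path_image c) \<subseteq> inside (f ` path_image c)"
proof -
  let ?C = "path_image c"
  note J = Jordan_inside_outside[OF c]
  have J_un: "inside ?C \<union> outside ?C = - ?C" and J_disj: "inside ?C \<inter> outside ?C = {}"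
    and J_unb: "\<not> bounded (outside ?C)" and J_open: "open (inside ?C)"
    and J_conn: "topological_space_class.connected (inside ?C)" "topological_space_class.connected (outside ?C)"
    using J by simp_all
  have J_sub: "inside ?C \<subseteq> - ?C" "outside ?C \<subseteq> - ?C" using J_un by blast+
  have wC: "w \<notin> ?C" and wO: "w \<notin> outside ?C" using w J_un J_disj by blast+
  have cont: "continuous_on S f" if "w \<notin> S" for S
    unfolding f_def using that by (intro continuous_intros) auto
  \<comment> \<open>As \<open>inverse 0 = 0\<close>, the map sends \<open>w\<close> to 0: it is
    injective on the whole plane, but continuous only away from \<open>w\<close>.\<close>
  have inj: "inj f" unfolding f_def inj_on_def by simp
  have sp: "simple_path (f \<circ> c)"
    by (intro simple_path_continuous_image c cont wC inj_on_subset[OF inj]) auto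
  have img: "path_image (f \<circ> c) = f ` ?C" by (rule path_image_compose)
  have lp: "pathfinish (f \<circ> c) = pathstart (f \<circ> c)"
    using c(2) by (simp add: pathfinish_compose pathstart_compose)
  note J' = Jordan_inside_outside[OF sp lp, unfolded img]
  have J'_un: "inside (f ` ?C) \<union> outside (f ` ?C) = - (f ` ?C)"
    and J'_disj: "inside (f ` ?C) \<inter> outside (f ` ?C) = {}"
    and J'_bdd: "bounded (inside (f ` ?C))" and J'_ne: "inside (f ` ?C) \<noteq> {}"
    and J'_open: "open (inside (f ` ?C))" "open (outside (f ` ?C))"
    using J' by simp_all
  have Iconn: "topological_space_class.connected (f ` (inside ?C - {w}))"
    using J_open J_conn by (intro connected_continuous_image cont connected_open_delete) auto
  have Iunb: "\<not> bounded (f ` (inside ?C - {w}))"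
  proof
    assume "bounded (f ` (inside ?C - {w}))"
    then obtain B where B: "B > 0" "\<And>z. z \<in> inside ?C - {w} \<Longrightarrow> norm (f z) \<le> B"
      by (metis bounded_pos imageI)
    obtain e where e: "e > 0" "ball w e \<subseteq> inside ?C"
      using J_open w open_contains_ball by meson
    \<comment> \<open>Small enough for \<open>w + d\<close> to remain inside the curve and for its
      image, of norm \<open>1 / d\<close>, to exceed the bound \<open>B\<close>.\<close>
    define d where "d = min (e / 2) (1 / (2 * B))"
    have d: "0 < d" "d < e" "d < 1 / B"
      using B(1) e(1) by (auto simp: d_def min_def field_simps)
    have "w + of_real d \<in> inside ?C - {w}"
      using d e(2) by (auto simp: dist_norm)
    from B(2)[OF this] have "1 / d \<le> B"
      using d(1) by (simp add: f_def norm_inverse norm_divide field_simps)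
    then show False using d B(1) by (simp add: field_simps)
  qed
  have Csub: "f ` (- ?C) \<subseteq> - (f ` ?C)"
    by (rule inj_image_Compl_subset[OF inj])
  have Isub: "f ` (inside ?C - {w}) \<subseteq> - (f ` ?C)"
    using subset_trans[OF image_mono Csub, of "inside ?C - {w}"] J_sub(1) by blast
  have Iout: "f ` (inside ?C - {w}) \<subseteq> outside (f ` ?C)"
  proof -
    have "f ` (inside ?C - {w}) \<inter> inside (f ` ?C) = {} \<or>
        f ` (inside ?C - {w}) \<inter> outside (f ` ?C) = {}"
      using connectedD[OF Iconn, of "inside (f ` ?C)" "outside (f ` ?C)", OF J'_open]
        J'_un J'_disj Isub by blast
    moreover have "\<not> f ` (inside ?C - {w}) \<subseteq> inside (f ` ?C)"
      using Iunb bounded_subset[OF J'_bdd] by blast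
    ultimately show ?thesis using J'_un Isub by blast
  qed
  have Oconn: "topological_space_class.connected (f ` outside ?C)"
    using J_conn wO by (intro connected_continuous_image cont) auto
  have zero: "0 \<in> closure (f ` outside ?C)"
  proof (unfold closure_approachable, intro allI impI)
    fix e :: real assume "e > 0"
    have "\<not> (outside ?C \<subseteq> cball w (1 / e))"
      using J_unb bounded_subset[OF bounded_cball] by blast
    then obtain z where z: "z \<in> outside ?C" "dist w z > 1 / e"
      by (metis mem_cball not_le subsetI)
    then have "1 / e < norm (z - w)" by (simp add: dist_norm norm_minus_commute)
    moreover have "0 < norm (z - w)" using z(1) wO by auto
    ultimately have "norm (f z) < e"
      using \<open>e > 0\<close> by (simp add: f_def norm_inverse norm_divide field_simps)
    then show "\<exists>y\<in>f ` outside ?C. dist y 0 < e" using z by auto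
  qed
  have O0: "topological_space_class.connected (insert 0 (f ` outside ?C))"
    by (rule connected_intermediate_closure[OF Oconn]) (use zero closure_subset[of "f ` outside ?C"] in blast)+
  have z0: "0 \<notin> f ` ?C" using wC by (auto simp: f_def)
  have Osub: "insert 0 (f ` outside ?C) \<subseteq> - (f ` ?C)"
    using subset_trans[OF image_mono[OF J_sub(2)] Csub] z0 by simp
  have cover: "y \<in> f ` (inside ?C - {w}) \<union> insert 0 (f ` outside ?C)" if "y \<notin> f ` ?C" for y
  proof (cases "y = 0")
    case False
    define z where "z = w + inverse y"
    have fz: "f z = y" "z \<noteq> w" using False by (auto simp: z_def f_def)
    then have "z \<notin> ?C" using that by blast
    then have "z \<in> inside ?C \<union> outside ?C" using J_un by blast
    then show ?thesis using fz by blast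
  qed auto
  obtain y where y: "y \<in> inside (f ` ?C)" using J'_ne by blast
  have "y \<notin> f ` ?C" using y J'_un by blast
  moreover have "y \<notin> outside (f ` ?C)" using y J'_disj by blast
  ultimately have "y \<in> insert 0 (f ` outside ?C)" using cover[of y] Iout by blast
  then have "inside (f ` ?C) \<inter> insert 0 (f ` outside ?C) \<noteq> {}" using y by blast
  then have "insert 0 (f ` outside ?C) \<inter> outside (f ` ?C) = {}"
    using connectedD[OF O0, of "inside (f ` ?C)" "outside (f ` ?C)", OF J'_open]
      J'_un J'_disj Osub by blast
  then show ?thesis using J'_un Osub by blast
qed

lemma arc_continuous_image:
  assumes "arc g" "continuous_on (path_image g) f" "inj_on f (path_image g)"
  shows "arc (f \<circ> g)"
  using assms unfolding arc_def
  by (auto intro: path_continuous_image comp_inj_on simp: path_image_def)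

text \<open>
  The arcs, \<open>Q\<close> and a connection from \<open>Q\<close> to \<open>p\<close> inside \<open>Z\<close> would draw \<open>K\<^sub>3\<^sub>,\<^sub>3\<close>.  If \<open>Z\<close> lies outside the closed curve, an inversion at a point inside reduces to the other case.
\<close>

lemma theta_no_crossing:
  fixes c1 c2 p :: "real \<Rightarrow> complex"
  assumes arcs: "arc c1" "arc c2" "arc p"
    and c1: "pathstart c1 = a" "pathfinish c1 = b"
    and c2: "pathstart c2 = a" "pathfinish c2 = b"
    and p: "pathstart p = a" "pathfinish p = b"
    and c12: "path_image c1 \<inter> path_image c2 = {a, b}"
    and i: "i \<in> path_image c1 - {a, b}" and j: "j \<in> path_image c2 - {a, b}"
    and Q: "topological_space_class.connected Q" "Q \<inter> path_image p = {}" "i \<in> closure Q" "j \<in> closure Q"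
    and Z: "topological_space_class.connected Z" "Z \<inter> (path_image c1 \<union> path_image c2) = {}"
      "Q \<subseteq> Z" "path_image p - {a, b} \<subseteq> Z"
  shows False
proof -
  let ?C1 = "path_image c1" and ?C2 = "path_image c2" and ?P = "path_image p"
  let ?C = "?C1 \<union> ?C2"
  have ends: "a \<in> ?C1" "b \<in> ?C1" "a \<in> ?C2" "b \<in> ?C2" "a \<in> ?P" "b \<in> ?P"
    using c1 c2 p by (metis pathstart_in_path_image pathfinish_in_path_image)+
  have c1p: "?C1 \<inter> ?P = {a, b}" and c2p: "?C2 \<inter> ?P = {a, b}"
    using ends Z(2,4) by blast+
  have sp: "simple_path (c1 +++ reversepath c2)"
    using arcs c1 c2 c12 by (intro simple_path_join_loop) (auto simp: arc_reversepath)
  have lp: "pathfinish (c1 +++ reversepath c2) = pathstart (c1 +++ reversepath c2)"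
    using c1 c2 by simp
  have img: "path_image (c1 +++ reversepath c2) = ?C"
    using c1 c2 by (simp add: path_image_join)
  note J = Jordan_inside_outside[OF sp lp, unfolded img]
  have J_un: "inside ?C \<union> outside ?C = - ?C" and J_disj: "inside ?C \<inter> outside ?C = {}"
    and J_ne: "inside ?C \<noteq> {}" and J_open: "open (inside ?C)" "open (outside ?C)"
    using J by simp_all
  have pne: "?P - {a, b} \<noteq> {}"
    using nonempty_simple_path_endless[OF arc_imp_simple_path[OF arcs(3)]] p by simp
  have "Z \<inter> inside ?C = {} \<or> Z \<inter> outside ?C = {}"
    using connectedD[OF Z(1), of "inside ?C" "outside ?C", OF J_open] J_un J_disj Z(2) by blast
  then consider "Z \<subseteq> inside ?C" | "Z \<subseteq> outside ?C" using J_un Z(2) by blast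
  then show False
  proof cases
    case 1
    then have "Q \<subseteq> inside ?C" "?P \<inter> inside ?C \<noteq> {}" using Z pne by blast+
    then show False
      using theta_inside_no_crossing[OF arcs c1 c2 p c12 c1p c2p i j Q(1,2)] Q(3,4) by blast
  next
    case 2
    obtain w where w: "w \<in> inside ?C" using J_ne by blast
    define f where "f = (\<lambda>z. inverse (z - w))"
    have cont: "continuous_on S f" if "w \<notin> S" for S
      unfolding f_def using that by (intro continuous_intros) auto
    have inj: "inj f" unfolding f_def inj_on_def by simp
    have wC: "w \<notin> ?C" "w \<notin> outside ?C" using w J_un J_disj by blast+
    have wP: "w \<notin> ?P" using Z(4) 2 wC ends by blast
    \<comment> \<open>The points \<open>i\<close> and \<open>j\<close> are only limits of
      \<open>Q\<close>, and \<open>f\<close> preserves limits only where it is continuous; so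
      \<open>w\<close> must lie off the closure of \<open>Q\<close>.\<close>
    have "inside ?C \<inter> closure Q = {}"
      using open_Int_closure_eq_empty[of "inside ?C" Q] J_open(1) J_disj 2 Z(3) by blast
    then have wQ: "w \<notin> closure Q" using w by blast
    have arcs': "arc (f \<circ> c1)" "arc (f \<circ> c2)" "arc (f \<circ> p)"
      using wC wP by (auto intro!: arc_continuous_image arcs cont intro: inj_on_subset[OF inj])
    have sub: "f ` outside ?C \<subseteq> inside (f ` ?C)"
      using inversion_outside_subset_inside[OF sp lp] w unfolding img f_def by blast
    have imgs: "path_image (f \<circ> c1) = f ` ?C1" "path_image (f \<circ> c2) = f ` ?C2"
      "path_image (f \<circ> p) = f ` ?P" by (simp_all add: path_image_compose)
    have cl: "f ` closure Q \<subseteq> closure (f ` Q)"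
      by (rule image_closure_subset[OF cont[OF wQ]]) (auto simp: closure_subset)
    have Qconn: "topological_space_class.connected (f ` Q)"
      using wQ closure_subset by (intro connected_continuous_image Q cont) auto
    have int: "f ` A \<inter> f ` B = f ` (A \<inter> B)" for A B
      using image_Int[OF inj] by metis
    show False
    proof (rule theta_inside_no_crossing[OF arcs', of "f a" "f b" "f i" "f j" "f ` Q"])
      show "f i \<in> path_image (f \<circ> c1) - {f a, f b}" "f j \<in> path_image (f \<circ> c2) - {f a, f b}"
        using i j inj by (auto simp: imgs dest: injD)
      show "path_image (f \<circ> p) \<inter> inside (path_image (f \<circ> c1) \<union> path_image (f \<circ> c2)) \<noteq> {}"
        unfolding imgs image_Un[symmetric] using sub pne Z(4) 2 by blast
      show "f ` Q \<subseteq> inside (path_image (f \<circ> c1) \<union> path_image (f \<circ> c2))"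
        unfolding imgs image_Un[symmetric] using sub Z(3) 2 by blast
    qed (use c1 c2 p Q cl Qconn in \<open>auto simp: imgs int c12 c1p c2p pathstart_compose pathfinish_compose\<close>)
  qed
qed

section \<open>Cycles and rooted trees\<close>

lemma pawalk_of_list:
  assumes "xs \<noteq> []" "successively (\<lambda>x y. (x, y) \<in> A) xs" "(last xs, y) \<in> A"
  defines "p \<equiv> zip xs (tl xs @ [y])"
  shows "pcas (hd xs) p y" "set p \<subseteq> A" "pawalk_verts (hd xs) p = xs @ [y]"
  using assms(1-3) unfolding p_def
proof (induction xs rule: list_nonempty_induct)
  case (cons x xs)
  { case 1 then show ?case using cons by (cases xs) auto }
  { case 2 then show ?case using cons by (cases xs) auto }
  { case 3 then show ?case using cons by (cases xs) auto }
qed auto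

text \<open>Read contrapositively, this turns the absence of cycles of arcs into a condition on
  lists of vertices, the form of acyclicity that \<open>rooting\<close> takes.\<close>

lemma cycle_of_list:
  assumes "distinct xs" "3 \<le> length xs" "successively (\<lambda>x y. (x, y) \<in> parcs T) xs"
    "(last xs, hd xs) \<in> parcs T" "hd xs \<in> pverts T"
  shows "\<exists>p. pre_digraph.cycle (with_proj T) p \<and> 3 \<le> length p"
proof -
  have ne: "xs \<noteq> []" using assms(2) by auto
  define p where "p = zip xs (tl xs @ [hd xs])"
  note W = pawalk_of_list[OF ne assms(3,4), folded p_def]
  have "length p = length xs" using ne by (auto simp: p_def)
  moreover have "distinct (tl (xs @ [hd xs]))" using assms(1) ne by (cases xs) auto
  ultimately show ?thesis
    using W assms ne
    by (intro exI[of _ p])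
      (auto simp: pre_digraph.cycle_def pre_digraph.awalk_def cas_with_proj_eq
        awalk_verts_with_proj_eq intro!: exI[of _ "hd xs"])
qed

lemma pcas_nth:
  assumes "pcas u p v"
  shows "pawalk_verts u p = map fst p @ [v]"
    and "i < length p \<Longrightarrow> snd (p ! i) = (map fst p @ [v]) ! Suc i"
  using assms
proof (induction p arbitrary: u i)
  case (Cons e p)
  { case 1 then show ?case using Cons by auto }
  { case 2 then show ?case using Cons
      by (cases i; cases p) (auto simp: nth_append) }
qed auto

text \<open>The first components of the arcs enumerate the vertices in cyclic order. Unordered pairs
  appear because both orientations of each arc belong to \<open>C\<close>.\<close>

lemma cycle_graph_list:
  assumes "cycle_graph C"
  obtains vs where "distinct vs" "3 \<le> length vs" "set vs = pverts C"
    "\<And>x y. (x, y) \<in> parcs C \<longleftrightarrow> (\<exists>i<length vs.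
       {x, y} = {vs ! i, vs ! (Suc i mod length vs)})"
proof -
  obtain p u where p: "pcas u p u" "distinct (tl (pawalk_verts u p))" "3 \<le> length p"
      "pverts C = fst ` set p" "parcs C = set p \<union> (set p)\<inverse>"
    using assms unfolding cycle_graph_def pre_digraph.cycle_def pre_digraph.awalk_def
    by (auto simp: cas_with_proj_eq awalk_verts_with_proj_eq)
  define vs where "vs = map fst p"
  have ne: "p \<noteq> []" using p(3) by auto
  have hd: "vs ! 0 = u" using p(1) ne by (cases p) (auto simp: vs_def)
  have "distinct (tl (vs @ [u]))" using p(1,2) pcas_nth(1) vs_def by metis
  then have dist: "distinct vs" using hd ne by (cases vs) (auto simp: vs_def)
  have nth: "p ! i = (vs ! i, vs ! (Suc i mod length vs))" if "i < length p" for i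
  proof -
    have "snd (p ! i) = (vs @ [u]) ! Suc i" using pcas_nth(2)[OF p(1) that] vs_def by simp
    also have "\<dots> = vs ! (Suc i mod length vs)"
      using that hd by (cases "Suc i = length vs") (auto simp: vs_def nth_append)
    finally show ?thesis using that by (simp add: vs_def prod_eq_iff)
  qed
  have "set p = (!) p ` {..<length p}" by (auto simp: set_conv_nth)
  also have "\<dots> = (\<lambda>i. (vs ! i, vs ! (Suc i mod length vs))) ` {..<length vs}"
    using nth by (intro image_cong) (simp_all add: vs_def)
  finally have "(x, y) \<in> parcs C \<longleftrightarrow> (\<exists>i<length vs. {x, y} = {vs ! i, vs ! (Suc i mod length vs)})"
    for x y unfolding p(5) by (auto simp: doubleton_eq_iff)
  then show thesis using that dist p(3,4) by (auto simp: vs_def)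
qed

lemma dep_ancestor:
  fixes dep :: "'a \<Rightarrow> nat"
  assumes "\<And>v. v \<in> V \<Longrightarrow> v \<noteq> r \<Longrightarrow> par v \<in> V \<and> dep v = Suc (dep (par v))"
    "v \<in> V" "k \<le> dep v" "dep r = 0"
  shows "(par ^^ k) v \<in> V \<and> dep ((par ^^ k) v) = dep v - k"
  using assms(3)
proof (induction k)
  case (Suc k)
  then have "(par ^^ k) v \<in> V" "dep ((par ^^ k) v) = dep v - k" "(par ^^ k) v \<noteq> r"
    using assms(4) by auto
  then show ?case using assms(1)[of "(par ^^ k) v"] by auto
qed (use assms in auto)

text \<open>The depth is the distance from \<open>r\<close>, and the parent is a neighbour one step
  closer. The point is that there are no further arcs: the climbs from the two ends of an arc to
  their first meeting close up with this arc to a cycle, which acyclicity keeps below three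
  vertices.\<close>

lemma rooting:
  fixes A :: "'a rel"
  assumes "sym A" "irrefl A" "A \<subseteq> V \<times> V" and r: "r \<in> V"
    and conn: "\<And>v. v \<in> V \<Longrightarrow> (r, v) \<in> A\<^sup>*"
    and acyclic: "\<And>xs. distinct xs \<Longrightarrow> 3 \<le> length xs \<Longrightarrow>
      successively (\<lambda>x y. (x, y) \<in> A) xs \<Longrightarrow> (last xs, hd xs) \<in> A \<Longrightarrow> False"
  obtains par :: "'a \<Rightarrow> 'a" and dep :: "'a \<Rightarrow> nat"
  where "par r = r" "dep r = 0" "\<And>v. v \<in> V \<Longrightarrow> par v \<in> V"
    "\<And>v. v \<in> V \<Longrightarrow> v \<noteq> r \<Longrightarrow> dep v = Suc (dep (par v))"
    "\<And>u v. (u, v) \<in> A \<longleftrightarrow> u \<in> V - {r} \<and> v = par u \<or> v \<in> V - {r} \<and> u = par v"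
proof -
  define dep where "dep v = (LEAST k. (r, v) \<in> A ^^ k)" for v
  have dep: "(r, v) \<in> A ^^ dep v" if "v \<in> V" for v
    unfolding dep_def using conn[OF that] rtrancl_imp_relpow LeastI_ex by metis
  have dep_le: "dep v \<le> k" if "(r, v) \<in> A ^^ k" for v k
    unfolding dep_def using that by (rule Least_le)
  have dep_r: "dep r = 0" using dep_le[of r 0] by simp
  have ex: "\<exists>u. (u, v) \<in> A \<and> dep v = Suc (dep u)" if v: "v \<in> V" "v \<noteq> r" for v
  proof -
    obtain k where k: "dep v = Suc k" using dep[OF v(1)] v(2) by (cases "dep v") auto
    then obtain u where u: "(r, u) \<in> A ^^ k" "(u, v) \<in> A"
      using dep[OF v(1)] by (metis relpow_Suc_E)
    then have "u \<in> V" using assms(3) by auto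
    then have "Suc k \<le> Suc (dep u)" using dep_le relpow_Suc_I[OF dep u(2)] k by metis
    then show ?thesis using u k dep_le[OF u(1)] by auto
  qed
  define par where "par v = (if v = r then r else SOME u. (u, v) \<in> A \<and> dep v = Suc (dep u))" for v
  have par_r: "par r = r" by (simp add: par_def)
  have par: "(par v, v) \<in> A" "dep v = Suc (dep (par v))" if "v \<in> V" "v \<noteq> r" for v
    using someI_ex[OF ex[OF that]] that(2) by (auto simp: par_def)
  have par_in: "par v \<in> V" if "v \<in> V" for v
    using par(1)[OF that] that assms(3) r by (cases "v = r") (auto simp: par_r)
  have chain: "(par ^^ k) v \<in> V \<and> dep ((par ^^ k) v) = dep v - k" if "v \<in> V" "k \<le> dep v" for v k
    using dep_ancestor[of V r par dep v k] par(2) par_in dep_r that by blast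
  have top: "(par ^^ dep v) v = r" if "v \<in> V" for v
    using chain[OF that order_refl] par(2) by fastforce
  have step: "((par ^^ Suc k) v, (par ^^ k) v) \<in> A" if "v \<in> V" "k < dep v" for v k
  proof -
    have "(par ^^ k) v \<in> V" "0 < dep ((par ^^ k) v)" using chain[of v k] that by auto
    then show ?thesis using par(1)[of "(par ^^ k) v"] dep_r by fastforce
  qed
  have symA: "(x, y) \<in> A \<longleftrightarrow> (y, x) \<in> A" for x y using assms(1) by (meson symE)
  have flip: "(\<lambda>x y. (y, x) \<in> A) = (\<lambda>x y. (x, y) \<in> A)" using symA by auto
  have adj: "v = par u \<or> u = par v" if uv: "(u, v) \<in> A" for u v
  proof -
    have V: "u \<in> V" "v \<in> V" using uv assms(3) by auto
    \<comment> \<open>The first index at which the climb from \<open>u\<close> hits the climb from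
      \<open>v\<close>. Bounding \<open>j\<close> by \<open>dep v\<close> stops the second climb at
      the root, where it would repeat vertices.\<close>
    define i where "i = (LEAST i. \<exists>j\<le>dep v. (par ^^ i) u = (par ^^ j) v)"
    have exi: "\<exists>j\<le>dep v. (par ^^ dep u) u = (par ^^ j) v" using top V by auto
    obtain j where j: "j \<le> dep v" "(par ^^ i) u = (par ^^ j) v"
      using LeastI[of "\<lambda>i. \<exists>j\<le>dep v. (par ^^ i) u = (par ^^ j) v", OF exi] i_def by auto
    have min: "(par ^^ i') u \<noteq> (par ^^ j') v" if "i' < i" "j' \<le> dep v" for i' j'
      using not_less_Least[of i' "\<lambda>i. \<exists>j\<le>dep v. (par ^^ i) u = (par ^^ j) v"] that i_def by auto
    have i: "i \<le> dep u" unfolding i_def by (rule Least_le) (use exi in auto)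
    \<comment> \<open>Up from \<open>u\<close> to just before the meeting vertex, then from that
      vertex down to \<open>v\<close>; these are \<open>i + j + 1\<close> vertices.\<close>
    define xs where "xs = map (\<lambda>k. (par ^^ k) u) [0..<i] @ rev (map (\<lambda>k. (par ^^ k) v) [0..<Suc j])"
    have inj: "inj_on (\<lambda>k. (par ^^ k) w) {..dep w}" if "w \<in> V" for w
      using chain[OF that] by (intro inj_onI) (metis atMost_iff diff_diff_cancel)
    have "distinct (map (\<lambda>k. (par ^^ k) w) [0..<m])" if "w \<in> V" "m \<le> Suc (dep w)" for w m
      using that by (auto simp: distinct_map intro!: inj_on_subset[OF inj])
    then have dist: "distinct xs"
      unfolding xs_def using V i j(1) min by (auto simp del: upt_Suc)
    have succ: "successively (\<lambda>x y. (x, y) \<in> A) (map (\<lambda>k. (par ^^ k) w) [0..<m])"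
      if "w \<in> V" "m \<le> Suc (dep w)" for w m
      using step[OF that(1)] that(2) symA by (auto simp: successively_conv_nth simp del: funpow.simps)
    have "successively (\<lambda>x y. (x, y) \<in> A) (rev (map (\<lambda>k. (par ^^ k) v) [0..<Suc j]))"
      unfolding successively_rev flip using j(1) by (intro succ V) simp
    moreover have "i \<noteq> 0 \<Longrightarrow> ((par ^^ (i - 1)) u, (par ^^ j) v) \<in> A"
      using step[OF V(1), of "i - 1"] i symA j(2) by (simp del: funpow.simps)
    moreover have "i \<noteq> 0 \<Longrightarrow> last (map (\<lambda>k. (par ^^ k) u) [0..<i]) = (par ^^ (i - 1)) u"
      by (simp add: last_map)
    ultimately have "i = 0 \<or> (last (map (\<lambda>k. (par ^^ k) u) [0..<i]), (par ^^ j) v) \<in> A"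
        "successively (\<lambda>x y. (x, y) \<in> A) (rev (map (\<lambda>k. (par ^^ k) v) [0..<Suc j]))"
      by (cases "i = 0"; simp)+
    then have sxs: "successively (\<lambda>x y. (x, y) \<in> A) xs"
      unfolding xs_def using succ[OF V(1), of i] i
      by (auto simp: successively_append_iff)
    have "last xs = v" unfolding xs_def by (simp add: last_rev hd_map del: upt_Suc)
    moreover have "hd xs = u"
      unfolding xs_def using j(2) by (cases "i = 0") (auto simp: hd_map upt_conv_Cons)
    moreover have "length xs = i + Suc j" by (simp add: xs_def)
    ultimately have "i + j < 2"
      using acyclic[OF dist _ sxs] uv symA by fastforce
    then consider "i = 0" "j = 0" | "i = 1" "j = 0" | "i = 0" "j = 1" by linarith
    then show ?thesis
      using j(2) uv assms(2) by cases (auto simp: irrefl_def)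
  qed
  have ne: "u \<noteq> r" if "(u, par u) \<in> A" for u
    using that par_r assms(2) by (auto simp: irrefl_def)
  have "(u, v) \<in> A \<longleftrightarrow> u \<in> V - {r} \<and> v = par u \<or> v \<in> V - {r} \<and> u = par v" for u v
  proof
    assume "u \<in> V - {r} \<and> v = par u \<or> v \<in> V - {r} \<and> u = par v"
    then show "(u, v) \<in> A" using par(1) symA[of v u] by auto
  next
    assume uv: "(u, v) \<in> A"
    then have "(v, u) \<in> A" "u \<in> V" "v \<in> V" using symA assms(3) by auto
    with adj[OF uv] show "u \<in> V - {r} \<and> v = par u \<or> v \<in> V - {r} \<and> u = par v"
      using ne[of u] ne[of v] uv by (elim disjE) simp_all
  qed
  then show thesis using that par_r dep_r par_in par(2) by blast
qed

section \<open>Ancestors and depth in a rooted tree\<close>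

text \<open>With \<open>par r = r\<close> the iterates of \<open>par\<close> become stationary at
  the root, so the \<open>k\<close>-th ancestor makes sense for every \<open>k\<close>, and
  truncated subtraction gives its depth.\<close>

locale rooted_tree =
  fixes V :: "'a set" and par :: "'a \<Rightarrow> 'a" and dep :: "'a \<Rightarrow> nat" and r :: 'a
  assumes finite_V: "finite V" and r_in: "r \<in> V"
    and par_r: "par r = r" and dep_r: "dep r = 0"
    and par_in: "v \<in> V \<Longrightarrow> par v \<in> V"
    and dep_par: "v \<in> V \<Longrightarrow> v \<noteq> r \<Longrightarrow> dep v = Suc (dep (par v))"
begin

definition below :: "'a \<Rightarrow> 'a \<Rightarrow> bool" where
  "below w v \<longleftrightarrow> (\<exists>k. (par ^^ k) v = w)"

lemma anc_in: "v \<in> V \<Longrightarrow> (par ^^ k) v \<in> V"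
  by (induction k) (auto intro: par_in)

lemma anc_r [simp]: "(par ^^ k) r = r"
  by (induction k) (auto simp: par_r)

lemma dep_anc: "v \<in> V \<Longrightarrow> dep ((par ^^ k) v) = dep v - k"
proof (induction k)
  case (Suc k)
  then show ?case
    using dep_par[of "(par ^^ k) v"] anc_in[of v k] dep_r par_r
    by (cases "(par ^^ k) v = r") auto
qed simp

lemma dep_eq_0: "v \<in> V \<Longrightarrow> dep v = 0 \<longleftrightarrow> v = r"
  using dep_par dep_r by fastforce

lemma anc_dep: "v \<in> V \<Longrightarrow> dep v \<le> k \<Longrightarrow> (par ^^ k) v = r"
  using dep_anc[of v k] anc_in[of v k] dep_eq_0[of "(par ^^ k) v"] by simp

text \<open>Each step up lowers the depth by one, so the two depths determine the exponent. A climb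
  that overshoots ends at \<open>r\<close>, whose depth 0 again yields a correct exponent.\<close>

lemma below_iff: "v \<in> V \<Longrightarrow> below w v \<longleftrightarrow> w = (par ^^ (dep v - dep w)) v"
proof
  assume v: "v \<in> V" and "below w v"
  then obtain k where k: "(par ^^ k) v = w" by (auto simp: below_def)
  show "w = (par ^^ (dep v - dep w)) v"
  proof (cases "k \<le> dep v")
    case True
    then show ?thesis using k dep_anc[OF v, of k] by simp
  next
    case False
    then show ?thesis using k anc_dep[OF v] dep_r by (metis diff_zero nat_le_linear)
  qed
qed (metis below_def)

lemma below_refl [simp]: "below v v"
  unfolding below_def by (rule exI[of _ 0]) simp

lemma below_trans: "below u v \<Longrightarrow> below v w \<Longrightarrow> below u w"
  unfolding below_def by (metis comp_apply funpow_add)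

lemma below_par: "below (par v) v"
  unfolding below_def by (rule exI[of _ 1]) simp

lemma below_in: "v \<in> V \<Longrightarrow> below w v \<Longrightarrow> w \<in> V"
  unfolding below_def using anc_in by blast

lemma below_dep: "v \<in> V \<Longrightarrow> below w v \<Longrightarrow> dep w \<le> dep v"
  unfolding below_def using dep_anc by fastforce

lemma below_cases:
  assumes "below w v" shows "w = v \<or> below w (par v)"
proof -
  obtain k where "(par ^^ k) v = w" using assms by (auto simp: below_def)
  then show ?thesis by (cases k) (auto simp: below_def funpow_swap1)
qed

lemma below_same_dep:
  "v \<in> V \<Longrightarrow> below u v \<Longrightarrow> below w v \<Longrightarrow> dep u = dep w \<Longrightarrow> u = w"
  by (metis below_iff)

lemma below_Suc_dep:
  assumes "v \<in> V" "below u v" "below w v" "dep u = Suc (dep w)"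
  shows "w = par u"
proof -
  have "u \<in> V" "u \<noteq> r" using assms below_in dep_r by auto
  then have "dep (par u) = dep w" using dep_par assms(4) by simp
  then show ?thesis using below_same_dep[OF assms(1)] below_trans[OF below_par assms(2)] assms(3) by metis
qed

end

text \<open>The root is the leaf with index 0 and \<open>t\<close> its only child; the other leaves
  have no children. Since \<open>n\<close> is the last index, it is also the number of leaves
  besides the root.\<close>

locale leafy_tree = rooted_tree +
  fixes vs :: "'a list" and n :: nat and t :: 'a
  assumes dist: "distinct vs" and len: "length vs = Suc n" and n2: "2 \<le> n"
    and vs0: "vs ! 0 = r" and vs_V: "set vs \<subseteq> V"
    and leaf_no_child: "v \<in> V \<Longrightarrow> v \<noteq> r \<Longrightarrow> par v \<in> set vs \<Longrightarrow> par v = r"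
    and nonleaf_child: "v \<in> V \<Longrightarrow> v \<notin> set vs \<Longrightarrow> \<exists>u\<in>V - {r}. par u = v"
    and t: "t \<in> V" "t \<noteq> r"
    and child_r: "v \<in> V \<Longrightarrow> v \<noteq> r \<Longrightarrow> par v = r \<longleftrightarrow> v = t"
begin

lemma vs_in [simp]: "i \<le> n \<Longrightarrow> vs ! i \<in> V"
  using vs_V len by (auto simp: subset_iff)

lemma vs_eq [simp]: "i \<le> n \<Longrightarrow> j \<le> n \<Longrightarrow> vs ! i = vs ! j \<longleftrightarrow> i = j"
  using dist len by (simp add: nth_eq_iff_index_eq)

lemma vs_ne_r [simp]: "1 \<le> i \<Longrightarrow> i \<le> n \<Longrightarrow> vs ! i \<noteq> r"
  using vs_eq[of i 0] vs0 by auto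

lemma in_vs: "v \<in> set vs \<longleftrightarrow> (\<exists>i\<le>n. v = vs ! i)"
  using len by (auto simp: in_set_conv_nth less_Suc_eq_le)

text \<open>A deepest vertex below \<open>v\<close> has no child, so it is a leaf. This makes the
  index set whose extremes are \<open>lo v\<close> and \<open>hi v\<close> nonempty.\<close>

lemma leaf_below:
  assumes "v \<in> V" "v \<noteq> r"
  shows "\<exists>i\<ge>1. i \<le> n \<and> below v (vs ! i)"
proof -
  define D where "D = {u \<in> V. below v u}"
  have "finite D" "v \<in> D" using finite_V assms by (auto simp: D_def)
  then have "Max (dep ` D) \<in> dep ` D" by (intro Max_in) auto
  then obtain u where u: "u \<in> D" "dep u = Max (dep ` D)" by auto
  have max: "dep u' \<le> dep u" if "u' \<in> D" for u'
    using that \<open>finite D\<close> u(2) by simp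
  have "u \<in> set vs"
  proof (rule ccontr)
    assume "u \<notin> set vs"
    then obtain x where x: "x \<in> V" "x \<noteq> r" "par x = u" using nonleaf_child u(1) D_def by auto
    then have "x \<in> D" using u(1) below_trans[OF _ below_par] by (auto simp: D_def)
    then show False using max[of x] dep_par[of x] x by simp
  qed
  then obtain i where i: "i \<le> n" "u = vs ! i" using in_vs by auto
  moreover have "\<not> below v r" using assms(2) by (auto simp: below_def)
  then have "i \<noteq> 0" using i u(1) vs0 by (cases i) (auto simp: D_def)
  ultimately show ?thesis using u(1) by (auto simp: D_def intro!: exI[of _ i])
qed

lemma anc_leaf_nonleaf:
  assumes "v \<in> V" "v \<noteq> w" "below w v" "w \<in> set vs" shows "w = r"
proof (rule ccontr)
  assume w: "w \<noteq> r"
  obtain k where k: "(par ^^ k) v = w" using assms(3) by (auto simp: below_def)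
  then obtain k' where k': "k = Suc k'" using assms(2) by (cases k) auto
  then have "par ((par ^^ k') v) = w" using k by simp
  moreover have "(par ^^ k') v \<noteq> r" using calculation w par_r by auto
  ultimately show False using leaf_no_child[of "(par ^^ k') v"] anc_in[OF assms(1)] assms(4) w by auto
qed

lemma t_par: "par t = r" using child_r t by blast

lemma dep_t: "dep t = 1" using dep_par t t_par dep_r by simp

lemma below_t:
  assumes "v \<in> V" "v \<noteq> r" shows "below t v"
proof -
  obtain k where k: "dep v = Suc k" using dep_eq_0[OF assms(1)] assms(2) by (cases "dep v") auto
  have "dep ((par ^^ k) v) = 1" using dep_anc[OF assms(1)] k by simp
  then have "(par ^^ k) v \<noteq> r" using dep_r by auto
  moreover have "par ((par ^^ k) v) = r" using anc_dep[OF assms(1), of "Suc k"] k by simp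
  ultimately have "(par ^^ k) v = t" using child_r[OF anc_in[OF assms(1), of k]] by blast
  then show ?thesis by (auto simp: below_def)
qed

text \<open>All vertices except the root lie below \<open>t\<close>, among them two different
  leaves; but a leaf other than the root has nothing below it except itself.\<close>

lemma t_nonleaf: "t \<notin> set vs"
proof
  assume "t \<in> set vs"
  then have "vs ! 1 = t" "vs ! 2 = t"
    using anc_leaf_nonleaf[of "vs ! 1" t] anc_leaf_nonleaf[of "vs ! 2" t] below_t n2 t(2) by auto
  then show False using vs_eq[of 1 2] n2 by auto
qed

lemma dep_ge_2: "v \<in> V \<Longrightarrow> v \<noteq> r \<Longrightarrow> v \<noteq> t \<Longrightarrow> 2 \<le> dep v"
  using child_r[of v] dep_par[of v] dep_eq_0[OF par_in[of v]] by simp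

definition B :: nat where "B = Suc (Max (dep ` V))"

lemma dep_less_B: "v \<in> V \<Longrightarrow> dep v < B"
  unfolding B_def using finite_V by (auto simp: less_Suc_eq_le)

lemma leaf_ne: "1 \<le> i \<Longrightarrow> i \<le> n \<Longrightarrow> vs ! i \<in> set vs \<and> vs ! i \<noteq> r \<and> vs ! i \<noteq> t"
  using t_nonleaf in_vs by auto

lemma leaf_dep: "1 \<le> i \<Longrightarrow> i \<le> n \<Longrightarrow> 2 \<le> dep (vs ! i) \<and> dep (vs ! i) < B"
  using dep_ge_2[of "vs ! i"] dep_less_B[of "vs ! i"] leaf_ne[of i] by auto

end

section \<open>The leaves below a vertex\<close>

text \<open>Supplies the limit points that \<open>theta_no_crossing\<close> asks for when
  \<open>Q\<close> is an arc without its ends.\<close>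

lemma endpoints_in_closure_endless:
  assumes "arc g"
  shows "{pathstart g, pathfinish g} \<subseteq> closure (path_image g - {pathstart g, pathfinish g})"
proof -
  have cont: "continuous_on (closure {0<..<1}) g"
    using assms by (simp add: arc_def path_def)
  have "g ` closure {0<..<1} \<subseteq> closure (path_image g - {pathstart g, pathfinish g})"
    using simple_path_endless[OF arc_imp_simple_path[OF assms]]
    by (intro image_closure_subset[OF cont]) (auto intro: closure_subset[THEN subsetD])
  then show ?thesis by (auto simp: pathstart_def pathfinish_def image_subset_iff)
qed

section \<open>Walks as arcs of a plane drawing\<close>

fun walk_edges :: "'a list \<Rightarrow> 'a set set" where
  "walk_edges (x # y # ws) = insert {x, y} (walk_edges (y # ws))"
| "walk_edges _ = {}"

lemma Union_walk_edges_subset: "\<Union> (walk_edges ws) \<subseteq> set ws"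
  by (induction ws rule: walk_edges.induct) auto

lemma walk_edges_append:
  "xs \<noteq> [] \<Longrightarrow> ys \<noteq> [] \<Longrightarrow>
    walk_edges (xs @ ys) = insert {last xs, hd ys} (walk_edges xs \<union> walk_edges ys)"
proof (induction xs rule: walk_edges.induct)
  case ("2_2" x)
  then show ?case by (cases ys) auto
qed auto

lemma walk_edges_upt:
  assumes "a \<le> b"
  shows "walk_edges (map g [a..<Suc b]) = {{g j, g (Suc j)} | j. a \<le> j \<and> j < b}"
  using assms
proof (induction b rule: dec_induct)
  case (step b)
  have "map g [a..<Suc (Suc b)] = map g [a..<Suc b] @ [g (Suc b)]" using step by simp
  moreover have "last (map g [a..<Suc b]) = g b" using step by simp
  ultimately have "walk_edges (map g [a..<Suc (Suc b)]) =
      insert {g b, g (Suc b)} {{g j, g (Suc j)} | j. a \<le> j \<and> j < b}"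
    using walk_edges_append[of "map g [a..<Suc b]" "[g (Suc b)]"] step by (simp del: upt_Suc)
  also have "\<dots> = {{g j, g (Suc j)} | j. a \<le> j \<and> j < Suc b}"
    using step by (auto simp: less_Suc_eq)
  finally show ?case .
qed auto

lemma walk_edges_rev [simp]: "walk_edges (rev ws) = walk_edges ws"
proof (induction ws rule: walk_edges.induct)
  case (1 x y ws)
  then show ?case
    using walk_edges_append[of "rev (y # ws)" "[x]"] by (simp add: last_rev insert_commute)
qed auto

text \<open>Stated for a bare edge set, so that it can be instantiated with tree and cycle edges in
  the form in which \<open>par\<close> and \<open>vs\<close> describe them.\<close>

locale plane_edges =
  fixes V :: "'a set" and E :: "'a set set" and f :: "'a \<Rightarrow> complex" and \<gamma> :: "'a set \<Rightarrow> real \<Rightarrow> complex"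
  assumes inj: "inj_on f V" and E_V: "e \<in> E \<Longrightarrow> e \<subseteq> V"
    and edge: "e \<in> E \<Longrightarrow> arc (\<gamma> e) \<and> {pathstart (\<gamma> e), pathfinish (\<gamma> e)} = f ` e \<and>
      path_image (\<gamma> e) \<inter> f ` V = f ` e"
    and disjoint: "e \<in> E \<Longrightarrow> e' \<in> E \<Longrightarrow> e \<noteq> e' \<Longrightarrow>
      path_image (\<gamma> e) \<inter> path_image (\<gamma> e') \<subseteq> f ` (e \<inter> e')"
begin

definition drawn :: "'a set set \<Rightarrow> complex set" where
  "drawn F = (\<Union>e\<in>F. path_image (\<gamma> e))"

lemma drawn_Int:
  assumes "F \<subseteq> E" "F' \<subseteq> E" "F \<inter> F' = {}" "\<Union> F \<subseteq> X" "\<Union> F' \<subseteq> Y"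
  shows "drawn F \<inter> drawn F' \<subseteq> f ` (X \<inter> Y)"
proof
  fix z assume "z \<in> drawn F \<inter> drawn F'"
  then obtain e e' where e: "e \<in> F" "e' \<in> F'" "z \<in> path_image (\<gamma> e) \<inter> path_image (\<gamma> e')"
    by (auto simp: drawn_def)
  then have "z \<in> f ` (e \<inter> e')" using disjoint[of e e'] assms(1-3) by blast
  then show "z \<in> f ` (X \<inter> Y)" using e assms(4,5) by blast
qed

lemma vertex_drawn_iff:
  assumes "F \<subseteq> E" "x \<in> V" shows "f x \<in> drawn F \<longleftrightarrow> x \<in> \<Union> F"
proof -
  have "f x \<in> path_image (\<gamma> e) \<longleftrightarrow> x \<in> e" if "e \<in> F" for e
  proof -
    have "f x \<in> path_image (\<gamma> e) \<longleftrightarrow> f x \<in> f ` e" using edge[of e] that assms by blast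
    then show ?thesis using inj_on_image_mem_iff[OF inj assms(2) E_V[of e]] that assms by blast
  qed
  then show ?thesis by (auto simp: drawn_def)
qed

text \<open>The edge arcs are joined one after the other. The result is simple because the vertices
  are distinct: the first edge meets the drawing of the remaining walk only in its second
  vertex.\<close>

lemma walk_arc:
  assumes "distinct ws" "2 \<le> length ws" "walk_edges ws \<subseteq> E"
  shows "\<exists>g. arc g \<and> pathstart g = f (hd ws) \<and> pathfinish g = f (last ws) \<and>
    path_image g = drawn (walk_edges ws)"
  using assms
proof (induction ws rule: walk_edges.induct)
  case (1 x y ws)
  have e: "{x, y} \<in> E" using 1 by simp
  have "x \<noteq> y" using 1 by simp
  \<comment> \<open>A drawing prescribes the ends of an edge only as an unordered pair, so the arc
    may have to be reversed.\<close>
  have "pathstart (\<gamma> {x, y}) \<noteq> pathfinish (\<gamma> {x, y})" using edge[OF e] arc_distinct_ends by metis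
  moreover have "{pathstart (\<gamma> {x, y}), pathfinish (\<gamma> {x, y})} = {f x, f y}"
    using edge[OF e] by simp
  ultimately have "pathstart (\<gamma> {x, y}) = f x \<and> pathfinish (\<gamma> {x, y}) = f y \<or>
      pathstart (\<gamma> {x, y}) = f y \<and> pathfinish (\<gamma> {x, y}) = f x"
    unfolding doubleton_eq_iff by blast
  then obtain h where h: "arc h" "pathstart h = f x" "pathfinish h = f y"
      "path_image h = path_image (\<gamma> {x, y})"
    using edge[OF e] by (metis arc_reversepath path_image_reversepath pathfinish_reversepath pathstart_reversepath)
  show ?case
  proof (cases ws)
    case Nil
    then show ?thesis using h by (intro exI[of _ h]) (simp add: drawn_def)
  next
    case (Cons z zs)
    then obtain g where g: "arc g" "pathstart g = f y" "pathfinish g = f (last ws)"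
        "path_image g = drawn (walk_edges (y # ws))"
      using 1 by auto
    have "{x, y} \<notin> walk_edges (y # ws)"
      using Union_walk_edges_subset[of "y # ws"] 1(2) by auto
    then have "drawn {{x, y}} \<inter> drawn (walk_edges (y # ws)) \<subseteq> f ` ({x, y} \<inter> set (y # ws))"
      using 1(4) Union_walk_edges_subset[of "y # ws"] by (intro drawn_Int) auto
    also have "{x, y} \<inter> set (y # ws) = {y}" using 1(2) by auto
    finally have "path_image h \<inter> path_image g \<subseteq> {f y}"
      unfolding h g drawn_def by simp
    then have "arc (h +++ g)" using h g by (intro arc_join) auto
    moreover have "path_image (h +++ g) = drawn (walk_edges (x # y # ws))"
      using h g by (simp add: path_image_join drawn_def)
    ultimately show ?thesis
      using h g Cons by (intro exI[of _ "h +++ g"]) auto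
  qed
qed auto

end

section \<open>Tree paths and the leaf cycle in the drawing\<close>

locale plane_halin = leafy_tree V par dep r vs n t +
  plane_edges V "{{v, par v} | v. v \<in> V - {r}} \<union> {{vs ! i, vs ! (Suc i mod length vs)} | i. i < length vs}" f \<gamma>
  for V :: "'a set" and par dep r vs n t f \<gamma>
begin

abbreviation "tree_edges \<equiv> {{v, par v} | v. v \<in> V - {r}}"
abbreviation "cycle_edges \<equiv> {{vs ! i, vs ! (Suc i mod length vs)} | i. i < length vs}"

definition up :: "'a \<Rightarrow> nat \<Rightarrow> 'a list" where
  "up v k = map (\<lambda>j. (par ^^ j) v) [0..<Suc k]"

lemma up_simps [simp]:
  "length (up v k) = Suc k" "hd (up v k) = v" "last (up v k) = (par ^^ k) v"
  "set (up v k) = (\<lambda>j. (par ^^ j) v) ` {..k}"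
proof -
  show "hd (up v k) = v" unfolding up_def by (subst upt_conv_Cons) auto
  show "set (up v k) = (\<lambda>j. (par ^^ j) v) ` {..k}"
    unfolding up_def by (simp only: set_map set_upt atLeast0LessThan lessThan_Suc_atMost)
qed (simp_all add: up_def)

lemma walk_edges_up: "walk_edges (up v k) = {{(par ^^ j) v, (par ^^ Suc j) v} | j. j < k}"
  unfolding up_def by (subst walk_edges_upt) auto

lemma walk_edges_up_mono:
  assumes "k \<le> l" shows "walk_edges (up v k) \<subseteq> walk_edges (up v l)"
proof
  fix e assume "e \<in> walk_edges (up v k)"
  then obtain j where "j < k" "e = {(par ^^ j) v, (par ^^ Suc j) v}" unfolding walk_edges_up by blast
  then show "e \<in> walk_edges (up v l)"
    unfolding walk_edges_up using assms by (intro CollectI exI[of _ j]) simp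
qed

lemma distinct_up: "v \<in> V \<Longrightarrow> k \<le> dep v \<Longrightarrow> distinct (up v k)"
  unfolding up_def distinct_map
  by (auto simp del: upt_Suc intro!: inj_onI) (metis dep_anc diff_diff_cancel le_trans less_Suc_eq_le)

lemma walk_edges_up_subset:
  assumes "v \<in> V" "k \<le> dep v" shows "walk_edges (up v k) \<subseteq> tree_edges"
proof -
  have "(par ^^ j) v \<in> V - {r}" if "j < k" for j
    using dep_anc[OF assms(1), of j] anc_in[OF assms(1), of j] dep_r that assms(2) by auto
  then show ?thesis unfolding walk_edges_up by auto
qed

text \<open>If the upper end is a leaf, it is the root; then the lower end is \<open>t\<close>,
  which is not a leaf. As cycle edges consist of leaves, tree and cycle share no edge.\<close>

lemma tree_edge_not_leaves: "e \<in> tree_edges \<Longrightarrow> \<not> e \<subseteq> set vs"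
  using leaf_no_child child_r t_nonleaf by auto

lemma cycle_edge_leaves: "e \<in> cycle_edges \<Longrightarrow> e \<subseteq> set vs"
  using len by auto

lemma up_leaves:
  assumes "1 \<le> i" "i \<le> n" shows "set (up (vs ! i) k) \<inter> set vs \<subseteq> {vs ! i, r}"
proof
  fix x assume "x \<in> set (up (vs ! i) k) \<inter> set vs"
  then have "below x (vs ! i)" "x \<in> set vs" by (auto simp: below_def)
  then show "x \<in> {vs ! i, r}" using anc_leaf_nonleaf[of "vs ! i" x] assms by auto
qed

text \<open>An instance of \<open>theta_no_crossing\<close>: \<open>c1\<close> is the part of the
  cycle from \<open>a\<close> to \<open>b\<close> through \<open>i\<close>, \<open>c2\<close> the
  complementary part through the root, \<open>p\<close> a path from \<open>a\<close> to
  \<open>b\<close> in the tree below \<open>w\<close>, and \<open>Q\<close> the tree path from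
  \<open>i\<close> to the root without its ends. The last two are disjoint because a common vertex
  would place \<open>i\<close> below \<open>w\<close>.\<close>

lemma contiguous_leaves:
  assumes w: "w \<in> V" "w \<noteq> r" and ab: "1 \<le> a" "a < i" "i < b" "b \<le> n"
    and below: "below w (vs ! a)" "below w (vs ! b)"
  shows "below w (vs ! i)"
proof (rule ccontr)
  assume nb: "\<not> below w (vs ! i)"
  let ?E = "tree_edges \<union> cycle_edges"
  have le: "a \<le> n" "i \<le> n" "b \<le> n" "1 \<le> i" "1 \<le> b" using ab by auto
  have wl: "w \<notin> set vs"
  proof
    assume "w \<in> set vs"
    then have "vs ! a = w" "vs ! b = w"
      using anc_leaf_nonleaf[of "vs ! a" w] anc_leaf_nonleaf[of "vs ! b" w] below w le by auto
    then show False using vs_eq[of a b] ab by simp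
  qed
  define cs1 where "cs1 = map ((!) vs) [a..<Suc b]"
  \<comment> \<open>The other way round: from \<open>a\<close> down to index 0, which is the root,
    across the closing edge to index \<open>n\<close>, and down to \<open>b\<close>.\<close>
  define cs2 where "cs2 = rev (map ((!) vs) [0..<Suc a]) @ rev (map ((!) vs) [b..<Suc n])"
  have cs1_set: "set cs1 = (!) vs ` {a..b}" unfolding cs1_def by (auto simp del: upt_Suc)
  have cs2_set: "set cs2 = (!) vs ` ({..a} \<union> {b..n})" unfolding cs2_def by (auto simp del: upt_Suc)
  have inj_vs: "inj_on ((!) vs) {..n}" by (auto simp: inj_on_def)
  have dist1: "distinct cs1" unfolding cs1_def distinct_map
    using ab by (auto simp del: upt_Suc intro: inj_on_subset[OF inj_vs])
  have dist2: "distinct cs2" unfolding cs2_def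
    using ab by (auto simp del: upt_Suc simp: distinct_map intro!: inj_on_subset[OF inj_vs])
  have step: "{vs ! j, vs ! Suc j} \<in> cycle_edges" if "j < n" for j
    using that len by (auto intro!: exI[of _ j])
  have wrap: "{vs ! 0, vs ! n} \<in> cycle_edges"
    using len by (auto intro!: exI[of _ n] simp: insert_commute)
  have we1: "walk_edges cs1 = {{vs ! j, vs ! Suc j} | j. a \<le> j \<and> j < b}"
    unfolding cs1_def using ab by (intro walk_edges_upt) simp
  have cs1E: "walk_edges cs1 \<subseteq> cycle_edges" using we1 step ab by force
  have ends: "hd (map ((!) vs) [j..<Suc k]) = vs ! j" "last (map ((!) vs) [j..<Suc k]) = vs ! k"
    "map ((!) vs) [j..<Suc k] \<noteq> []" if "j \<le> k" for j k
    using that by (auto simp: hd_append hd_map last_map)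
  have we2: "walk_edges cs2 = insert {vs ! 0, vs ! n}
      ({{vs ! j, vs ! Suc j} | j. 0 \<le> j \<and> j < a} \<union> {{vs ! j, vs ! Suc j} | j. b \<le> j \<and> j < n})"
    unfolding cs2_def using ends[of 0 a] ends[of b n] ab
    by (subst walk_edges_append)
      (simp_all add: walk_edges_upt last_rev hd_rev del: upt_Suc)
  have cs2E: "walk_edges cs2 \<subseteq> cycle_edges" unfolding we2 using step wrap ab by force
  have len2: "2 \<le> length cs1" "2 \<le> length cs2" using ab by (auto simp: cs1_def cs2_def)
  have hd_last: "hd cs1 = vs ! a" "last cs1 = vs ! b" "hd cs2 = vs ! a" "last cs2 = vs ! b"
    using ends[of a b] ends[of 0 a] ends[of b n] ab
    by (simp_all add: cs1_def cs2_def hd_rev last_rev hd_append last_append del: upt_Suc)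
  obtain c1 where c1: "arc c1" "pathstart c1 = f (vs ! a)" "pathfinish c1 = f (vs ! b)"
      "path_image c1 = drawn (walk_edges cs1)"
    using walk_arc[OF dist1 len2(1) le_supI2[OF cs1E]] unfolding hd_last by blast
  obtain c2 where c2: "arc c2" "pathstart c2 = f (vs ! a)" "pathfinish c2 = f (vs ! b)"
      "path_image c2 = drawn (walk_edges cs2)"
    using walk_arc[OF dist2 len2(2) le_supI2[OF cs2E]] unfolding hd_last by blast
  have "set cs1 \<inter> set cs2 = (!) vs ` ({a..b} \<inter> ({..a} \<union> {b..n}))"
    unfolding cs1_set cs2_set using ab
    by (intro inj_on_image_Int[symmetric, OF inj_vs]) auto
  also have "{a..b} \<inter> ({..a} \<union> {b..n}) = {a, b}" using ab by auto
  finally have set12: "set cs1 \<inter> set cs2 = {vs ! a, vs ! b}" by simp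
  \<comment> \<open>A common edge would join \<open>vs ! a\<close> and \<open>vs ! b\<close>, but
    the edges of \<open>cs1\<close> join consecutive indices and \<open>i\<close> lies strictly
    between \<open>a\<close> and \<open>b\<close>.\<close>
  have no_common: "walk_edges cs1 \<inter> walk_edges cs2 = {}"
  proof (rule ccontr)
    assume "walk_edges cs1 \<inter> walk_edges cs2 \<noteq> {}"
    then obtain e where e: "e \<in> walk_edges cs1" "e \<in> walk_edges cs2" by blast
    then have "e \<subseteq> {vs ! a, vs ! b}"
      using Union_walk_edges_subset[of cs1] Union_walk_edges_subset[of cs2] set12 by blast
    moreover obtain j where "a \<le> j" "j < b" "e = {vs ! j, vs ! Suc j}" using e(1) we1 by blast
    ultimately have "j = a \<or> j = b" "Suc j = a \<or> Suc j = b" using ab by auto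
    then show False using ab \<open>j < b\<close> by linarith
  qed
  have ends_in: "f (vs ! a) \<in> path_image c1" "f (vs ! b) \<in> path_image c1"
    "f (vs ! a) \<in> path_image c2" "f (vs ! b) \<in> path_image c2"
    using c1(2,3) c2(2,3) by (metis pathstart_in_path_image pathfinish_in_path_image)+
  have "path_image c1 \<inter> path_image c2 \<subseteq> f ` (set cs1 \<inter> set cs2)"
    unfolding c1(4) c2(4)
    by (rule drawn_Int[OF le_supI2[OF cs1E] le_supI2[OF cs2E] no_common
          Union_walk_edges_subset Union_walk_edges_subset])
  then have c12: "path_image c1 \<inter> path_image c2 = {f (vs ! a), f (vs ! b)}"
    using ends_in unfolding set12 by auto
  have f_eq: "f x = f y \<longleftrightarrow> x = y" if "x \<in> V" "y \<in> V" for x y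
    using that inj_on_eq_iff[OF inj] by simp
  have "{vs ! i, vs ! Suc i} \<in> walk_edges cs1" unfolding we1 using ab by auto
  then have "f (vs ! i) \<in> path_image c1"
    unfolding c1(4) vertex_drawn_iff[OF le_supI2[OF cs1E] vs_in[OF le(2)]] by blast
  then have vin: "f (vs ! i) \<in> path_image c1 - {f (vs ! a), f (vs ! b)}"
    using f_eq[of "vs ! i" "vs ! a"] f_eq[of "vs ! i" "vs ! b"] le ab by simp
  have "f (vs ! 0) \<in> path_image c2"
    unfolding c2(4) vertex_drawn_iff[OF le_supI2[OF cs2E] vs_in[OF le0]] using we2 by blast
  then have rin: "f r \<in> path_image c2 - {f (vs ! a), f (vs ! b)}"
    using f_eq[of r "vs ! a"] f_eq[of r "vs ! b"] le ab vs0 r_in vs_ne_r[of a] vs_ne_r[of b]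
    by (metis Diff_iff empty_iff insert_iff vs_in)
  have up_arc: "\<exists>g. arc g \<and> pathstart g = f v \<and> pathfinish g = f ((par ^^ k) v) \<and>
      path_image g = drawn (walk_edges (up v k))" if "v \<in> V" "k \<le> dep v" "1 \<le> k" for v k
    using walk_arc[OF distinct_up[OF that(1,2)]] walk_edges_up_subset[OF that(1,2)] that(3)
    by (simp add: le_supI1)
  have "\<exists>g. arc g \<and> pathstart g = f (vs ! j) \<and> pathfinish g = f r \<and>
      path_image g = drawn (walk_edges (up (vs ! j) (dep (vs ! j))))" if "1 \<le> j" "j \<le> n" for j
    using up_arc[of "vs ! j" "dep (vs ! j)"] anc_dep[of "vs ! j"] leaf_dep[OF that] that by simp
  then obtain arm where arm: "\<And>j. 1 \<le> j \<Longrightarrow> j \<le> n \<Longrightarrow> arc (arm j) \<and> pathstart (arm j) = f (vs ! j) \<and>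
      pathfinish (arm j) = f r \<and> path_image (arm j) = drawn (walk_edges (up (vs ! j) (dep (vs ! j))))"
    by metis
  \<comment> \<open>Both ends of an arm are leaves and lie on the cycle; without them the arm avoids
    it.\<close>
  define Z where "Z j = path_image (arm j) - {f (vs ! j), f r}" for j
  have Zconn: "topological_space_class.connected (Z j)" if "1 \<le> j" "j \<le> n" for j
    using connected_simple_path_endless[OF arc_imp_simple_path] arm[OF that] unfolding Z_def by metis
  have upE: "walk_edges (up (vs ! j) k) \<subseteq> tree_edges \<union> cycle_edges"
    if "j \<le> n" "k \<le> dep (vs ! j)" for j k
    using walk_edges_up_subset[OF vs_in that(2)] that(1) by blast
  \<comment> \<open>Every arm passes through \<open>t\<close> just before the root. This common
    point is what makes the union of arms connected.\<close>
  have Zt: "f t \<in> Z j" if j: "1 \<le> j" "j \<le> n" for j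
  proof -
    have "t = (par ^^ (dep (vs ! j) - 1)) (vs ! j)"
      using below_iff[of "vs ! j" t] below_t[of "vs ! j"] dep_t j by simp
    then have "{t, par t} \<in> walk_edges (up (vs ! j) (dep (vs ! j)))"
      unfolding walk_edges_up using leaf_dep[OF j] by (auto intro!: exI[of _ "dep (vs ! j) - 1"])
    then have "f t \<in> path_image (arm j)"
      using arm[OF j] upE[OF j(2) order_refl] t(1) by (auto simp: vertex_drawn_iff)
    then show ?thesis using f_eq leaf_ne[OF j] t r_in j by (auto simp: Z_def)
  qed
  have ZC: "Z j \<inter> (path_image c1 \<union> path_image c2) = {}" if j: "1 \<le> j" "j \<le> n" for j
  proof -
    let ?F = "walk_edges (up (vs ! j) (dep (vs ! j)))"
    have "path_image (arm j) \<inter> (path_image c1 \<union> path_image c2) =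
        drawn ?F \<inter> drawn (walk_edges cs1 \<union> walk_edges cs2)"
      using arm[OF j] c1(4) c2(4) by (auto simp: drawn_def)
    also have "\<dots> \<subseteq> f ` (set (up (vs ! j) (dep (vs ! j))) \<inter> set vs)"
    proof (rule drawn_Int)
      show "?F \<inter> (walk_edges cs1 \<union> walk_edges cs2) = {}"
      proof (rule ccontr)
        assume "\<not> ?thesis"
        then obtain e where e: "e \<in> ?F" "e \<in> walk_edges cs1 \<union> walk_edges cs2" by blast
        show False
          using tree_edge_not_leaves[OF subsetD[OF walk_edges_up_subset[OF vs_in[OF j(2)] order_refl] e(1)]]
            cycle_edge_leaves[OF subsetD[OF Un_least[OF cs1E cs2E] e(2)]] by (rule notE)
      qed
      show "\<Union> (walk_edges cs1 \<union> walk_edges cs2) \<subseteq> set vs"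
        by (intro Union_least cycle_edge_leaves subsetD[OF Un_least[OF cs1E cs2E]])
    qed (rule upE[OF j(2) order_refl] le_supI2[OF Un_least[OF cs1E cs2E]] Union_walk_edges_subset)+
    also have "\<dots> \<subseteq> {f (vs ! j), f r}" using up_leaves[OF j] by blast
    finally show ?thesis unfolding Z_def by blast
  qed
  \<comment> \<open>The initial stretch of the arm, from the leaf up to \<open>w\<close>.\<close>
  define P where "P j = drawn (walk_edges (up (vs ! j) (dep (vs ! j) - dep w)))" for j
  have P_w: "path_connected (P j)" "f (vs ! j) \<in> P j" "f w \<in> P j" "P j - {f (vs ! j)} \<subseteq> Z j"
    "P j \<inter> path_image (arm i) = {}"
    if j: "1 \<le> j" "j \<le> n" "below w (vs ! j)" for j
  proof -
    define k where "k = dep (vs ! j) - dep w"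
    have w_eq: "w = (par ^^ k) (vs ! j)" using below_iff[of "vs ! j" w] j k_def by simp
    have "w \<noteq> vs ! j" using wl leaf_ne[OF j(1,2)] by auto
    then have "k \<noteq> 0" using w_eq by (cases k) auto
    then have k: "1 \<le> k" "k \<le> dep (vs ! j)" "dep w = dep (vs ! j) - k" "dep w \<noteq> 0"
      using k_def below_dep[OF vs_in j(3)] j dep_eq_0[OF w(1)] w(2) by auto
    have P_def: "P j = drawn (walk_edges (up (vs ! j) k))" by (simp add: P_def k_def)
    obtain g where g: "arc g" "pathstart g = f (vs ! j)" "pathfinish g = f w" "path_image g = P j"
      using up_arc[of "vs ! j" k] k j w_eq P_def by auto
    show "path_connected (P j)" "f (vs ! j) \<in> P j" "f w \<in> P j"
      using path_connected_path_image[OF arc_imp_path[OF g(1)]]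
        pathstart_in_path_image[of g] pathfinish_in_path_image[of g] unfolding g by auto
    have "dep x \<noteq> 0" if "x \<in> set (up (vs ! j) k)" for x
      using that dep_anc[OF vs_in[OF j(2)]] k by auto
    then have "r \<notin> set (up (vs ! j) k)" using dep_r by blast
    then have "f r \<notin> P j"
      unfolding P_def vertex_drawn_iff[OF upE[OF j(2) k(2)] r_in]
      using Union_walk_edges_subset[of "up (vs ! j) k"] by blast
    moreover have "walk_edges (up (vs ! j) k) \<subseteq> walk_edges (up (vs ! j) (dep (vs ! j)))"
      using k(2) by (rule walk_edges_up_mono)
    then have "P j \<subseteq> path_image (arm j)"
      using arm[OF j(1,2)] unfolding P_def drawn_def by auto
    ultimately show "P j - {f (vs ! j)} \<subseteq> Z j" unfolding Z_def by blast
    have none: "set (up (vs ! j) k) \<inter> set (up (vs ! i) (dep (vs ! i))) = {}"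
    proof (rule ccontr)
      assume "\<not> ?thesis"
      then obtain l m where lm: "l \<le> k" "(par ^^ l) (vs ! j) = (par ^^ m) (vs ! i)" by auto
      then have "w = (par ^^ (k - l)) ((par ^^ m) (vs ! i))"
        using w_eq funpow_add[of "k - l" l par] by simp
      then have "below w ((par ^^ m) (vs ! i))" "below ((par ^^ m) (vs ! i)) (vs ! i)"
        unfolding below_def by blast+
      then show False using nb below_trans by blast
    qed
    have "drawn (walk_edges (up (vs ! j) k)) \<inter> drawn (walk_edges (up (vs ! i) (dep (vs ! i))))
        \<subseteq> f ` (set (up (vs ! j) k) \<inter> set (up (vs ! i) (dep (vs ! i))))"
    proof (rule drawn_Int)
      have "e \<noteq> {}" if "e \<in> walk_edges (up (vs ! j) k)" for e
        using that unfolding walk_edges_up by auto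
      then show "walk_edges (up (vs ! j) k) \<inter> walk_edges (up (vs ! i) (dep (vs ! i))) = {}"
        using none Union_walk_edges_subset[of "up (vs ! j) k"]
          Union_walk_edges_subset[of "up (vs ! i) (dep (vs ! i))"] by blast
    qed (rule upE[OF j(2) k(2)] upE[OF le(2) order_refl] Union_walk_edges_subset)+
    then show "P j \<inter> path_image (arm i) = {}"
      using none arm[OF le(4,2)] P_def by auto
  qed
  \<comment> \<open>The two stretches may merge before they reach \<open>w\<close>, so joining them
    need not give a simple curve; an arc is extracted from their path connected union
    instead.\<close>
  have "path_connected (P a \<union> P b)"
    using P_w[of a] P_w[of b] ab le below by (intro path_connected_Un) auto
  moreover have "f (vs ! a) \<noteq> f (vs ! b)" using c1 arc_distinct_ends by metis
  ultimately obtain p where p: "arc p" "path_image p \<subseteq> P a \<union> P b"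
      "pathstart p = f (vs ! a)" "pathfinish p = f (vs ! b)"
    using P_w(2)[of a] P_w(2)[of b] ab le below unfolding path_connected_arcwise by blast
  show False
  proof (rule theta_no_crossing[of c1 c2 p "f (vs ! a)" "f (vs ! b)" "f (vs ! i)" "f r" "Z i" "Z a \<union> Z i \<union> Z b"])
    show "f (vs ! i) \<in> closure (Z i)" "f r \<in> closure (Z i)"
      using endpoints_in_closure_endless[of "arm i"] arm[of i] le unfolding Z_def by auto
    show "Z i \<inter> path_image p = {}"
      using p(2) P_w(5)[of a] P_w(5)[of b] ab le below unfolding Z_def by blast
    show "topological_space_class.connected (Z a \<union> Z i \<union> Z b)"
      using Zt[of a] Zt[of b] Zt[of i] Zconn[of a] Zconn[of b] Zconn[of i] ab le
      by (intro connected_Un) auto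
    show "(Z a \<union> Z i \<union> Z b) \<inter> (path_image c1 \<union> path_image c2) = {}"
      using ZC[of a] ZC[of b] ZC[of i] ab le by blast
    show "path_image p - {f (vs ! a), f (vs ! b)} \<subseteq> Z a \<union> Z i \<union> Z b"
      using p(2) P_w(4)[of a] P_w(4)[of b] ab le below by blast
    show "topological_space_class.connected (Z i)" using Zconn le by blast
  qed (use c1 c2 p c12 vin rin in auto)
qed

end

section \<open>One-bend representations of Halin graphs\<close>

text \<open>Natural coordinates turn the later incidence questions into arithmetic on
  \<open>nat\<close>. Each leg is given by ordered bounds, so the direction in which a path runs
  along it is forgotten.\<close>

definition hook :: "nat \<Rightarrow> nat \<Rightarrow> nat \<Rightarrow> nat \<Rightarrow> nat \<Rightarrow> nat \<Rightarrow> complex set" where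
  "hook x y1 y2 y x1 x2 = {z. Re z = x \<and> y1 \<le> Im z \<and> Im z \<le> y2} \<union> {z. Im z = y \<and> x1 \<le> Re z \<and> Re z \<le> x2}"

definition hook_path :: "nat \<Rightarrow> nat \<Rightarrow> nat \<Rightarrow> nat \<Rightarrow> real \<Rightarrow> complex" where
  "hook_path x y' y x' = polyline [Complex x y', Complex x y, Complex x' y]"

lemma closed_segment_vertical:
  "closed_segment (Complex x a) (Complex x b) = {z. Re z = x \<and> min a b \<le> Im z \<and> Im z \<le> max a b}"
  by (auto simp: closed_segment_same_Re closed_segment_eq_real_ivl)

lemma closed_segment_horizontal:
  "closed_segment (Complex a y) (Complex b y) = {z. Im z = y \<and> min a b \<le> Re z \<and> Re z \<le> max a b}"
  by (auto simp: closed_segment_same_Im closed_segment_eq_real_ivl)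

lemma path_image_hook_path:
  "path_image (hook_path x y' y x') = hook x (min y y') (max y y') y (min x x') (max x x')"
  by (auto simp: hook_path_def hook_def path_image_join closed_segment_vertical
      closed_segment_horizontal simp flip: of_nat_min of_nat_max)

lemma bend_path_hook_path:
  assumes "x \<noteq> x'" "y \<noteq> y'"
  shows "bend_path 1 (hook_path x y' y x')"
  unfolding bend_path_def
proof (intro exI conjI)
  let ?ps = "[Complex x y', Complex x y, Complex x' y]"
  show "hook_path x y' y x' = polyline ?ps" by (simp add: hook_path_def)
  show "arc (hook_path x y' y x')"
    unfolding hook_path_def using assms
    by (auto intro!: arc_join simp: closed_segment_vertical closed_segment_horizontal
        complex_eq_iff)
  show "\<forall>i\<le>1. horizontal (?ps ! i) (?ps ! Suc i) \<or> vertical (?ps ! i) (?ps ! Suc i)"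
    using assms by (auto simp: le_Suc_eq horizontal_def vertical_def)
  show "\<forall>i<1. horizontal (?ps ! i) (?ps ! Suc i) = vertical (?ps ! Suc i) (?ps ! Suc (Suc i))"
    using assms by (auto simp: horizontal_def vertical_def)
qed simp

text \<open>One alternative for each pair of legs: overlapping parallel legs share the larger of
  their lower bounds, perpendicular legs their crossing point.\<close>

lemma hook_meets_iff:
  assumes "a1 \<le> a2" "b1 \<le> b2" "c1 \<le> c2" "d1 \<le> d2"
  shows "hook x a1 a2 y b1 b2 \<inter> hook x' c1 c2 y' d1 d2 \<noteq> {} \<longleftrightarrow>
    x = x' \<and> a1 \<le> c2 \<and> c1 \<le> a2 \<or> y = y' \<and> b1 \<le> d2 \<and> d1 \<le> b2 \<or>
    d1 \<le> x \<and> x \<le> d2 \<and> a1 \<le> y' \<and> y' \<le> a2 \<or> b1 \<le> x' \<and> x' \<le> b2 \<and> c1 \<le> y \<and> y \<le> c2"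
    (is "?L \<longleftrightarrow> ?R")
proof
  assume ?L
  then obtain z where z: "z \<in> hook x a1 a2 y b1 b2" "z \<in> hook x' c1 c2 y' d1 d2" by blast
  let ?V = "\<lambda>x a1 a2. Re z = real x \<and> real a1 \<le> Im z \<and> Im z \<le> real a2"
  let ?H = "\<lambda>y b1 b2. Im z = real y \<and> real b1 \<le> Re z \<and> Re z \<le> real b2"
  consider "?V x a1 a2" "?V x' c1 c2" | "?H y b1 b2" "?H y' d1 d2"
    | "?V x a1 a2" "?H y' d1 d2" | "?H y b1 b2" "?V x' c1 c2"
    using z unfolding hook_def by blast
  then show ?R
  proof cases
    case 1
    then have "real x = x'" "real a1 \<le> c2" "real c1 \<le> a2" by linarith+
    then show ?thesis by simp
  next
    case 2
    then have "real y = y'" "real b1 \<le> d2" "real d1 \<le> b2" by linarith+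
    then show ?thesis by simp
  next
    case 3
    then have "real d1 \<le> x" "real x \<le> d2" "real a1 \<le> y'" "real y' \<le> a2" by linarith+
    then show ?thesis by simp
  next
    case 4
    then have "real b1 \<le> x'" "real x' \<le> b2" "real c1 \<le> y" "real y \<le> c2" by linarith+
    then show ?thesis by simp
  qed
next
  assume ?R
  then consider "x = x'" "a1 \<le> c2" "c1 \<le> a2" | "y = y'" "b1 \<le> d2" "d1 \<le> b2"
    | "d1 \<le> x" "x \<le> d2" "a1 \<le> y'" "y' \<le> a2" | "b1 \<le> x'" "x' \<le> b2" "c1 \<le> y" "y \<le> c2"
    by blast
  then show ?L
  proof cases
    case 1
    then have "Complex x (max a1 c1) \<in> hook x a1 a2 y b1 b2 \<inter> hook x' c1 c2 y' d1 d2"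
      using assms by (auto simp: hook_def)
    then show ?thesis by blast
  next
    case 2
    then have "Complex (max b1 d1) y \<in> hook x a1 a2 y b1 b2 \<inter> hook x' c1 c2 y' d1 d2"
      using assms by (auto simp: hook_def)
    then show ?thesis by blast
  next
    case 3
    then have "Complex x y' \<in> hook x a1 a2 y b1 b2 \<inter> hook x' c1 c2 y' d1 d2"
      using assms by (auto simp: hook_def)
    then show ?thesis by blast
  next
    case 4
    then have "Complex x' y \<in> hook x a1 a2 y b1 b2 \<inter> hook x' c1 c2 y' d1 d2"
      using assms by (auto simp: hook_def)
    then show ?thesis by blast
  qed
qed

text \<open>The construction of the curves uses planarity through this one assumption.\<close>

locale halin_tree = leafy_tree +
  assumes contiguous: "w \<in> V \<Longrightarrow> w \<noteq> r \<Longrightarrow> 1 \<le> a \<Longrightarrow> a < i \<Longrightarrow> i < b \<Longrightarrow> b \<le> n \<Longrightarrow>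
      below w (vs ! a) \<Longrightarrow> below w (vs ! b) \<Longrightarrow> below w (vs ! i)"
begin

definition ix :: "'a \<Rightarrow> nat set" where "ix v = {i. 1 \<le> i \<and> i \<le> n \<and> below v (vs ! i)}"
definition lo :: "'a \<Rightarrow> nat" where "lo v = Min (ix v)"
definition hi :: "'a \<Rightarrow> nat" where "hi v = Max (ix v)"

lemma finite_ix [simp]: "finite (ix v)"
  by (rule finite_subset[of _ "{..n}"]) (auto simp: ix_def)

text \<open>Contiguity gives the forward direction of the last claim: between the extreme leaves
  below \<open>v\<close> no leaf is missing.\<close>

lemma lo_hi:
  assumes "v \<in> V" "v \<noteq> r"
  shows "1 \<le> lo v" "lo v \<le> hi v" "hi v \<le> n"
    and "lo v \<le> i \<and> i \<le> hi v \<longleftrightarrow> 1 \<le> i \<and> i \<le> n \<and> below v (vs ! i)"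
proof -
  have ne: "ix v \<noteq> {}" using leaf_below[OF assms] by (auto simp: ix_def)
  have m: "lo v \<in> ix v" "hi v \<in> ix v" using ne by (auto simp: lo_def hi_def)
  then show 1: "1 \<le> lo v" "hi v \<le> n" by (auto simp: ix_def)
  show "lo v \<le> hi v" using m by (simp add: lo_def)
  have "below v (vs ! i)" if "lo v \<le> i" "i \<le> hi v"
    using that m contiguous[OF assms, of "lo v" i "hi v"] 1
    by (cases "i = lo v \<or> i = hi v") (auto simp: ix_def)
  moreover have "lo v \<le> i \<and> i \<le> hi v" if "i \<in> ix v"
    using that by (auto simp: lo_def hi_def)
  ultimately show "lo v \<le> i \<and> i \<le> hi v \<longleftrightarrow> 1 \<le> i \<and> i \<le> n \<and> below v (vs ! i)"
    using 1 by (auto simp: ix_def)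
qed

definition pos :: "'a \<Rightarrow> nat" where "pos v = (THE i. i \<le> n \<and> v = vs ! i)"

lemma pos_vs [simp]: "i \<le> n \<Longrightarrow> pos (vs ! i) = i"
  unfolding pos_def by (rule the_equality) auto

text \<open>
  Depth grows upwards, and the leaf \<open>vs ! i\<close> sits at abscissa \<open>2 * i\<close>; the odd right ends keep the
  horizontal parts of different branches apart.  An inner vertex hangs on the horizontal part of its
  parent.  Each leaf but the first reaches back to its predecessor along the line of height \<open>B\<close>.  The
  root, a leaf itself, runs along height \<open>Suc B\<close>, where it meets its child \<open>t\<close> and the first leaf, and
  turns at abscissa \<open>2 * n\<close> to meet the last leaf.
\<close>

definition curve :: "'a \<Rightarrow> real \<Rightarrow> complex" where
  "curve v =
    (if v = r then hook_path (2 * n) B (Suc B) 0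
     else if v = t then hook_path 0 (Suc B) 1 (2 * n + 1)
     else if v \<notin> set vs then hook_path (2 * lo v) (dep v - 1) (dep v) (2 * hi v + 1)
     else if v = vs ! 1 then hook_path 2 (dep v - 1) (Suc B) 4
     else hook_path (2 * pos v) (dep v - 1) B (2 * pos v - 2))"

lemma bend_curve:
  assumes "v \<in> V" shows "bend_path 1 (curve v)"
proof -
  have "2 * pos v \<noteq> 2 * pos v - 2" if "v \<noteq> r" "v \<in> set vs"
    using that vs0 in_vs by (metis bot_nat_0.not_eq_extremum diff_less nat_0_less_mult_iff
      pos_vs zero_less_numeral less_irrefl_nat)
  moreover have "2 * a \<noteq> 2 * b + 1" for a b :: nat by presburger
  ultimately show ?thesis
    using n2 dep_less_B[OF assms] dep_ge_2[OF assms] lo_hi(1-3)[OF assms]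
    by (auto simp: curve_def simp del: One_nat_def intro!: bend_path_hook_path)
qed

lemma image_r: "path_image (curve r) = hook (2 * n) B (Suc B) (Suc B) 0 (2 * n)"
  by (simp add: curve_def path_image_hook_path)

lemma image_t: "path_image (curve t) = hook 0 1 (Suc B) 1 0 (2 * n + 1)"
  using t by (simp add: curve_def path_image_hook_path)

lemma image_inner:
  assumes "v \<in> V" "v \<noteq> r" "v \<noteq> t" "v \<notin> set vs"
  shows "path_image (curve v) = hook (2 * lo v) (dep v - 1) (dep v) (dep v) (2 * lo v) (2 * hi v + 1)"
  using assms lo_hi(2)[OF assms(1,2)] by (simp add: curve_def path_image_hook_path)

text \<open>The horizontal leg from 2 to 4 merely provides the bend: the corner at
  \<open>(2, Suc B)\<close> already lies on the line of the root.\<close>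

lemma image_1:
  "path_image (curve (vs ! 1)) = hook 2 (dep (vs ! 1) - 1) (Suc B) (Suc B) 2 4"
proof -
  have "min (Suc B) (dep (vs ! 1) - 1) = dep (vs ! 1) - 1"
    "max (Suc B) (dep (vs ! 1) - 1) = Suc B" using leaf_dep[of 1] n2 by linarith+
  then show ?thesis using n2 leaf_ne[of 1] by (simp add: curve_def path_image_hook_path)
qed

lemma image_leaf:
  assumes "2 \<le> i" "i \<le> n"
  shows "path_image (curve (vs ! i)) = hook (2 * i) (dep (vs ! i) - 1) B B (2 * i - 2) (2 * i)"
proof -
  have "min B (dep (vs ! i) - 1) = dep (vs ! i) - 1" "max B (dep (vs ! i) - 1) = B"
    using leaf_dep[of i] assms by linarith+
  then show ?thesis using assms leaf_ne[of i] by (simp add: curve_def path_image_hook_path)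
qed

section \<open>Which curves meet\<close>

text \<open>A curve of depth \<open>d\<close> occupies the heights from \<open>d - 1\<close> to
  \<open>d\<close>, so only equal or consecutive depths can meet. The left end \<open>lo v\<close>
  is the index of a leaf below \<open>v\<close>; if it falls into the interval of \<open>w\<close>,
  both are ancestors of this leaf. Equal depths then force \<open>v = w\<close>, and consecutive
  ones make one the parent of the other.\<close>

lemma inner_inner:
  assumes v: "v \<in> V" "v \<noteq> r" "v \<noteq> t" "v \<notin> set vs" and w: "w \<in> V" "w \<noteq> r" "w \<noteq> t" "w \<notin> set vs"
    and "v \<noteq> w"
  shows "path_image (curve v) \<inter> path_image (curve w) \<noteq> {} \<longleftrightarrow> v = par w \<or> w = par v"
proof -
  have 1: "x = y" if "x \<in> V" "x \<noteq> r" "y \<in> V" "y \<noteq> r" "lo y \<le> lo x" "lo x \<le> hi y" "dep x = dep y" for x y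
    using lo_hi[OF that(1,2)] lo_hi(4)[OF that(3,4), of "lo x"] lo_hi(4)[OF that(1,2), of "lo x"]
      below_same_dep[of "vs ! lo x" x y] that by auto
  have 2: "y = par x" if "x \<in> V" "x \<noteq> r" "y \<in> V" "y \<noteq> r" "lo y \<le> lo x" "lo x \<le> hi y" "dep x = Suc (dep y)" for x y
    using lo_hi[OF that(1,2)] lo_hi(4)[OF that(3,4), of "lo x"] lo_hi(4)[OF that(1,2), of "lo x"]
      below_Suc_dep[of "vs ! lo x" x y] that by auto
  have 3: "dep x = Suc (dep y) \<and> lo y \<le> lo x \<and> lo x \<le> hi y" if "x \<in> V" "x \<noteq> r" "y \<noteq> r" "y = par x" for x y
    using lo_hi[OF that(1,2)] lo_hi(4)[OF par_in[OF that(1)], of "lo x"] lo_hi(4)[OF that(1,2), of "lo x"]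
      that dep_par[OF that(1,2)] below_trans[OF below_par[of x]] by auto
  note L = lo_hi(1-3)[OF v(1,2)] lo_hi(1-3)[OF w(1,2)] dep_ge_2[OF v(1-3)] dep_ge_2[OF w(1-3)]
  have "path_image (curve v) \<inter> path_image (curve w) \<noteq> {} \<longleftrightarrow>
    2 * lo v = 2 * lo w \<and> dep v - 1 \<le> dep w \<and> dep w - 1 \<le> dep v \<or>
    dep v = dep w \<and> 2 * lo v \<le> 2 * hi w + 1 \<and> 2 * lo w \<le> 2 * hi v + 1 \<or>
    2 * lo w \<le> 2 * lo v \<and> 2 * lo v \<le> 2 * hi w + 1 \<and> dep v - 1 \<le> dep w \<and> dep w \<le> dep v \<or>
    2 * lo v \<le> 2 * lo w \<and> 2 * lo w \<le> 2 * hi v + 1 \<and> dep w - 1 \<le> dep v \<and> dep v \<le> dep w"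
    (is "_ \<longleftrightarrow> ?M")
    unfolding image_inner[OF v] image_inner[OF w] using L by (intro hook_meets_iff) auto
  also have "?M \<longleftrightarrow>
    (lo w \<le> lo v \<and> lo v \<le> hi w \<or> lo v \<le> lo w \<and> lo w \<le> hi v) \<and> dep v = dep w \<or>
    (lo w \<le> lo v \<and> lo v \<le> hi w) \<and> dep v = Suc (dep w) \<or>
    (lo v \<le> lo w \<and> lo w \<le> hi v) \<and> dep w = Suc (dep v)"
  proof -
    have odd: "2 * a \<le> 2 * b + 1 \<longleftrightarrow> a \<le> b" for a b :: nat by presburger
    consider "dep v = dep w" | "dep v = Suc (dep w)" | "dep w = Suc (dep v)"
      | "Suc (dep w) < dep v" | "Suc (dep v) < dep w" by linarith
    then show ?thesis unfolding odd by cases (use L in auto)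
  qed
  also have "\<dots> \<longleftrightarrow> v = par w \<or> w = par v"
    using 1[OF v(1,2) w(1,2)] 1[OF w(1,2) v(1,2)] 2[OF v(1,2) w(1,2)] 2[OF w(1,2) v(1,2)]
      3[OF v(1,2) w(2)] 3[OF w(1,2) v(2)] \<open>v \<noteq> w\<close> by metis
  finally show ?thesis .
qed

text \<open>The vertical leg of \<open>t\<close> stands at abscissa 0, left of all inner curves, so
  only its line at height 1 matters. It is reached exactly from depth 2, and since \<open>t\<close>
  is above every inner vertex, depth 2 means being its child.\<close>

lemma inner_t:
  assumes v: "v \<in> V" "v \<noteq> r" "v \<noteq> t" "v \<notin> set vs"
  shows "path_image (curve v) \<inter> path_image (curve t) \<noteq> {} \<longleftrightarrow> t = par v"
proof -
  note L = lo_hi(1-3)[OF v(1,2)] dep_ge_2[OF v(1-3)] dep_par[OF v(1,2)] dep_less_B[OF v(1)]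
  have "t = par v \<longleftrightarrow> dep v = 2"
    using below_same_dep[OF v(1) below_par below_t[OF v(1,2)]] dep_t dep_par[OF v(1,2)] by auto
  then show ?thesis
    unfolding image_inner[OF v] image_t using L by (subst hook_meets_iff) auto
qed

text \<open>The second claim lets the vertical leg of a leaf rise freely: an inner vertex whose
  interval contains \<open>i\<close> is a proper ancestor, so its line is not above the foot of the
  leaf at height \<open>dep (vs ! i) - 1\<close>, and only the parent attains this height.\<close>

lemma inner_leaf:
  assumes v: "v \<in> V" "v \<noteq> r" "v \<notin> set vs" and i: "1 \<le> i" "i \<le> n"
  shows "v = par (vs ! i) \<longleftrightarrow> lo v \<le> i \<and> i \<le> hi v \<and> dep v = dep (vs ! i) - 1"
    "lo v \<le> i \<Longrightarrow> i \<le> hi v \<Longrightarrow> dep v < dep (vs ! i)"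
proof -
  have "v \<noteq> vs ! i" using v i in_vs by auto
  show 1: "dep v < dep (vs ! i)" if "lo v \<le> i" "i \<le> hi v"
  proof -
    have "below v (vs ! i)" using lo_hi(4)[OF v(1,2), of i] that by auto
    then have "below v (par (vs ! i))" using below_cases \<open>v \<noteq> vs ! i\<close> by blast
    then have "dep v \<le> dep (par (vs ! i))" using below_dep par_in i by simp
    then show ?thesis using dep_par[of "vs ! i"] i by simp
  qed
  show "v = par (vs ! i) \<longleftrightarrow> lo v \<le> i \<and> i \<le> hi v \<and> dep v = dep (vs ! i) - 1"
    using lo_hi(4)[OF v(1,2), of i] below_par[of "vs ! i"] i dep_par[of "vs ! i"]
      below_same_dep[of "vs ! i" v "par (vs ! i)"] by auto
qed

lemma inner_leaf_meets:
  assumes v: "v \<in> V" "v \<noteq> r" "v \<noteq> t" "v \<notin> set vs" and i: "1 \<le> i" "i \<le> n"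
  shows "path_image (curve v) \<inter> path_image (curve (vs ! i)) \<noteq> {} \<longleftrightarrow> v = par (vs ! i)"
proof -
  note L = lo_hi(1-3)[OF v(1,2)] dep_ge_2[OF v(1-3)] dep_less_B[OF v(1)] leaf_dep[OF i]
  show ?thesis
  proof (cases "i = 1")
    case True
    then show ?thesis
      unfolding inner_leaf(1)[OF v(1,2,4) i] unfolding True image_inner[OF v] image_1
      using L True inner_leaf(2)[OF v(1,2,4) i] by (subst hook_meets_iff) auto
  next
    case False
    then have "2 \<le> i" using i by simp
    then show ?thesis
      unfolding inner_leaf(1)[OF v(1,2,4) i] unfolding image_inner[OF v] image_leaf[OF \<open>2 \<le> i\<close> i(2)]
      using L i inner_leaf(2)[OF v(1,2,4) i] by (subst hook_meets_iff) auto
  qed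
qed

lemma leaf_par_t: "1 \<le> i \<Longrightarrow> i \<le> n \<Longrightarrow> t = par (vs ! i) \<longleftrightarrow> dep (vs ! i) = 2"
  using below_same_dep[of "vs ! i" "par (vs ! i)" t] below_par below_t[of "vs ! i"] dep_t
    dep_par[of "vs ! i"] by auto

lemma t_leaf:
  assumes "1 \<le> i" "i \<le> n"
  shows "path_image (curve t) \<inter> path_image (curve (vs ! i)) \<noteq> {} \<longleftrightarrow> t = par (vs ! i)"
proof (cases "i = 1")
  case True
  then show ?thesis using leaf_dep[OF assms] n2 unfolding leaf_par_t[OF assms]
    unfolding True image_t image_1 by (subst hook_meets_iff) auto
next
  case False
  then have "2 \<le> i" using assms by simp
  then show ?thesis using assms leaf_dep[OF assms] unfolding leaf_par_t[OF assms]
    unfolding image_t image_leaf[OF \<open>2 \<le> i\<close> assms(2)] by (subst hook_meets_iff) auto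
qed

lemma t_r: "path_image (curve t) \<inter> path_image (curve r) \<noteq> {}"
  unfolding image_t image_r by (subst hook_meets_iff) auto

lemma inner_r:
  assumes v: "v \<in> V" "v \<noteq> r" "v \<noteq> t" "v \<notin> set vs"
  shows "path_image (curve v) \<inter> path_image (curve r) = {}"
proof -
  note L = lo_hi(1-3)[OF v(1,2)] dep_ge_2[OF v(1-3)] dep_less_B[OF v(1)]
  have "\<not> path_image (curve v) \<inter> path_image (curve r) \<noteq> {}"
    unfolding image_inner[OF v] image_r using L by (subst hook_meets_iff) auto
  then show ?thesis by blast
qed

text \<open>Leaves other than the first stop at height \<open>B\<close>, where the root is present
  only at abscissa \<open>2 * n\<close>, the corner of the last leaf.\<close>

lemma r_leaf:
  assumes i: "1 \<le> i" "i \<le> n"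
  shows "path_image (curve r) \<inter> path_image (curve (vs ! i)) \<noteq> {} \<longleftrightarrow> i = 1 \<or> i = n"
proof (cases "i = 1")
  case True
  then show ?thesis using leaf_dep[OF i] unfolding True image_r image_1
    using n2 by (subst hook_meets_iff) auto
next
  case False
  then have "2 \<le> i" using i by simp
  then show ?thesis using i leaf_dep[OF i] unfolding image_r image_leaf[OF \<open>2 \<le> i\<close> i(2)]
    by (subst hook_meets_iff) auto
qed

text \<open>The free end of leaf \<open>j\<close> at height \<open>B\<close> touches the corner of
  leaf \<open>j - 1\<close>, or for \<open>j = 2\<close> the taller vertical leg of the first
  leaf.\<close>

lemma leaf_leaf:
  assumes i: "1 \<le> i" "i < j" "j \<le> n"
  shows "path_image (curve (vs ! i)) \<inter> path_image (curve (vs ! j)) \<noteq> {} \<longleftrightarrow> j = Suc i"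
proof (cases "i = 1")
  case True
  then show ?thesis using i leaf_dep[of i] leaf_dep[of j] unfolding True image_1
    by (subst image_leaf; (subst hook_meets_iff)?) auto
next
  case False
  then have "2 \<le> i" "2 \<le> j" "i \<le> n" using i by simp_all
  then show ?thesis using i leaf_dep[of i] leaf_dep[of j]
    unfolding image_leaf[OF \<open>2 \<le> i\<close> \<open>i \<le> n\<close>] image_leaf[OF \<open>2 \<le> j\<close> i(3)]
    by (subst hook_meets_iff) auto
qed

section \<open>Meeting curves and adjacency\<close>

definition tree_adj :: "'a \<Rightarrow> 'a \<Rightarrow> bool" where
  "tree_adj u v \<longleftrightarrow> u \<noteq> r \<and> v = par u \<or> v \<noteq> r \<and> u = par v"

definition cyc_adj :: "'a \<Rightarrow> 'a \<Rightarrow> bool" where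
  "cyc_adj u v \<longleftrightarrow> (\<exists>i<length vs. {u, v} = {vs ! i, vs ! (Suc i mod length vs)})"

lemma cyc_adj_in: "cyc_adj u v \<Longrightarrow> u \<in> set vs \<and> v \<in> set vs"
proof -
  assume "cyc_adj u v"
  then obtain i where "i < length vs" "{u, v} = {vs ! i, vs ! (Suc i mod length vs)}"
    by (auto simp: cyc_adj_def)
  moreover have "Suc i mod length vs < length vs" using len by simp
  ultimately show ?thesis by (metis doubleton_eq_iff nth_mem)
qed

lemma cyc_adj_vs:
  assumes "i < j" "j \<le> n"
  shows "cyc_adj (vs ! i) (vs ! j) \<longleftrightarrow> j = Suc i \<or> i = 0 \<and> j = n"
proof -
  have "{vs ! i, vs ! j} = {vs ! k, vs ! (Suc k mod Suc n)} \<longleftrightarrow>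
      (if k = n then i = 0 \<and> j = n else i = k \<and> j = Suc k)" if "k \<le> n" for k
    using assms that n2 by (auto simp: doubleton_eq_iff)
  then have "cyc_adj (vs ! i) (vs ! j) \<longleftrightarrow> (\<exists>k\<le>n. if k = n then i = 0 \<and> j = n else i = k \<and> j = Suc k)"
    unfolding cyc_adj_def len less_Suc_eq_le by (intro ex_cong1 conj_cong refl)
  also have "\<dots> \<longleftrightarrow> j = Suc i \<or> i = 0 \<and> j = n"
  proof
    assume "j = Suc i \<or> i = 0 \<and> j = n"
    then show "\<exists>k\<le>n. if k = n then i = 0 \<and> j = n else i = k \<and> j = Suc k"
    proof
      assume "j = Suc i" then show ?thesis using assms by (intro exI[of _ i]) auto
    next
      assume "i = 0 \<and> j = n" then show ?thesis by (intro exI[of _ n]) auto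
    qed
  qed (auto split: if_splits)
  finally show ?thesis .
qed

lemma not_tree_adj_vs:
  assumes "i < j" "j \<le> n" shows "\<not> tree_adj (vs ! i) (vs ! j)"
proof -
  have "par (vs ! k) \<notin> set vs" if "1 \<le> k" "k \<le> n" for k
    using leaf_no_child[of "vs ! k"] child_r[of "vs ! k"] leaf_ne[OF that] that by auto
  then have no: "par (vs ! k) \<noteq> vs ! m" if "1 \<le> k" "k \<le> n" "m \<le> n" for k m
    using that in_vs by blast
  show ?thesis
    using no[of j i] no[of i j] assms vs0 unfolding tree_adj_def by (cases i) auto
qed

text \<open>Both sides are symmetric. So it suffices to compare inner vertices other than
  \<open>t\<close> with everything, \<open>t\<close> with the leaves, and leaves in increasing order
  of index, the root being the leaf with index 0.\<close>

lemma curve_meets_iff: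
  assumes "u \<in> V" "v \<in> V" "u \<noteq> v"
  shows "path_image (curve u) \<inter> path_image (curve v) \<noteq> {} \<longleftrightarrow> tree_adj u v \<or> cyc_adj u v"
    (is "?M u v \<longleftrightarrow> _")
proof -
  let ?A = "\<lambda>u v. tree_adj u v \<or> cyc_adj u v"
  have sym: "?M x y \<longleftrightarrow> ?M y x" "?A x y \<longleftrightarrow> ?A y x" for x y
    by (auto simp: tree_adj_def cyc_adj_def insert_commute)
  have par_leaf: "par x \<noteq> y" if "x \<in> V" "y \<in> set vs" "x \<noteq> r" "x \<noteq> t" for x y
    using leaf_no_child[OF that(1,3)] child_r[OF that(1,3)] that by auto
  have r_in_vs: "r \<in> set vs" using vs0 in_vs by auto
  have leaf: "y = r \<or> (\<exists>i\<ge>1. i \<le> n \<and> y = vs ! i)" if "y \<in> set vs" for y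
    using that vs0 in_vs by (metis Suc_leI One_nat_def bot_nat_0.not_eq_extremum)
  have inner: "?M x y \<longleftrightarrow> ?A x y"
    if x: "x \<in> V" "x \<notin> set vs" "x \<noteq> t" and y: "y \<in> V" "x \<noteq> y" for x y
  proof -
    have xr: "x \<noteq> r" using x r_in_vs by auto
    have nc: "\<not> cyc_adj x y" using cyc_adj_in x by blast
    consider "y \<notin> set vs" "y \<noteq> t" "y \<noteq> r" | "y = t" | "y = r" | i where "1 \<le> i" "i \<le> n" "y = vs ! i"
      using leaf r_in_vs by metis
    then show ?thesis
    proof cases
      case 1
      then show ?thesis using inner_inner[OF x(1) xr x(3,2) y(1)] nc xr y by (auto simp: tree_adj_def)
    next
      case 2
      have "x \<noteq> par t" using t_par xr by simp
      then show ?thesis using inner_t[OF x(1) xr x(3,2)] nc xr 2 t by (auto simp: tree_adj_def)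
    next
      case 3
      then show ?thesis using inner_r[OF x(1) xr x(3,2)] nc child_r[OF x(1) xr] x(3) xr
        by (auto simp: tree_adj_def)
    next
      case 4
      have "par x \<noteq> y" using par_leaf[OF x(1)] 4 leaf_ne xr x(3) by blast
      then show ?thesis
        using inner_leaf_meets[OF x(1) xr x(3,2) 4(1,2)] nc 4 leaf_ne[OF 4(1,2)] by (auto simp: tree_adj_def)
    qed
  qed
  have top: "?M t y \<longleftrightarrow> ?A t y" if y: "y \<in> set vs" for y
  proof -
    have nc: "\<not> cyc_adj t y" using cyc_adj_in t_nonleaf by blast
    from leaf[OF y] show ?thesis
    proof (elim disjE exE conjE)
      assume "y = r"
      then show ?thesis using t_r t_par t by (auto simp: tree_adj_def)
    next
      fix i assume i: "1 \<le> i" "i \<le> n" "y = vs ! i"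
      then show ?thesis using t_leaf[OF i(1,2)] t_par leaf_ne[OF i(1,2)] nc by (auto simp: tree_adj_def)
    qed
  qed
  have leaves: "?M (vs ! i) (vs ! j) \<longleftrightarrow> ?A (vs ! i) (vs ! j)" if ij: "i < j" "j \<le> n" for i j
  proof (cases "i = 0")
    case True
    then show ?thesis using r_leaf[of j] ij cyc_adj_vs[OF ij] not_tree_adj_vs[OF ij] vs0 by auto
  next
    case False
    then show ?thesis using leaf_leaf[of i j] ij cyc_adj_vs[OF ij] not_tree_adj_vs[OF ij] by simp
  qed
  consider "u \<notin> set vs" "u \<noteq> t" | "v \<notin> set vs" "v \<noteq> t" | "u = t" "v \<in> set vs" | "v = t" "u \<in> set vs"
    | "u \<in> set vs" "v \<in> set vs" using assms(3) by auto
  then show ?thesis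
  proof cases
    case 1 then show ?thesis using inner[of u v] assms by blast
  next
    case 2 then show ?thesis using inner[of v u] assms sym[of u v] by blast
  next
    case 3 then show ?thesis using top by blast
  next
    case 4 then show ?thesis using top[of u] sym[of u v] by blast
  next
    case 5
    then obtain i j where ij: "i \<le> n" "j \<le> n" "u = vs ! i" "v = vs ! j" using in_vs by auto
    then consider "i < j" | "j < i" using assms(3) by fastforce
    then show ?thesis using leaves[of i j] leaves[of j i] ij sym[of u v] by cases blast+
  qed
qed

end

section \<open>From Halin graphs to rooted trees\<close>

lemma out_degree_card: "out_degree (with_proj G) v = card {w. (v, w) \<in> parcs G}"
proof -
  have "out_arcs (with_proj G) v = Pair v ` {w. (v, w) \<in> parcs G}" by (auto simp: out_arcs_def)
  then show ?thesis by (simp add: out_degree_def card_image inj_on_def)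
qed

lemma rtrancl_on_subset: "rtrancl_on F A \<subseteq> A\<^sup>*"
proof
  fix x assume "x \<in> rtrancl_on F A"
  then show "x \<in> A\<^sup>*" by (induction x rule: prod.induct) (erule rtrancl_on_induct; auto)
qed

lemma tree_graph_rooting:
  assumes T: "tree_graph T" and r: "r \<in> pverts T"
  obtains par :: "'a \<Rightarrow> 'a" and dep :: "'a \<Rightarrow> nat"
  where "rooted_tree (pverts T) par dep r"
    "\<And>u v. (u, v) \<in> parcs T \<longleftrightarrow> u \<in> pverts T - {r} \<and> v = par u \<or> v \<in> pverts T - {r} \<and> u = par v"
proof -
  interpret pair_graph T using T by (simp add: tree_graph_def)
  have sym: "sym (parcs T)" using sym_arcs by (simp add: symmetric_def)
  have irr: "irrefl (parcs T)" using no_loops' by (auto simp: irrefl_def)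
  have sub: "parcs T \<subseteq> pverts T \<times> pverts T" using in_arcsD1 in_arcsD2 by auto
  \<comment> \<open>Connectedness is defined through the symmetric closure, which here is
    \<open>T\<close> itself.\<close>
  have "strongly_connected (with_proj (mk_symmetric (with_proj T)))"
    using T by (simp add: tree_graph_def Digraph_Component.connected_def)
  moreover have "parcs (mk_symmetric (with_proj T)) = parcs T"
    using sym by (auto simp: mk_symmetric_def sym_def)
  moreover have "pverts (mk_symmetric (with_proj T)) = pverts T" by (simp add: mk_symmetric_def)
  ultimately have conn: "(r, v) \<in> (parcs T)\<^sup>*" if "v \<in> pverts T" for v
    using that r rtrancl_on_subset[of "pverts T" "parcs T"]
    by (auto simp: strongly_connected_def reachable_def)
  have acyclic: False if "distinct xs" "3 \<le> length xs" "successively (\<lambda>x y. (x, y) \<in> parcs T) xs"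
      "(last xs, hd xs) \<in> parcs T" for xs
    using cycle_of_list[OF that] in_arcsD2[OF that(4)] T by (auto simp: tree_graph_def)
  obtain par :: "'a \<Rightarrow> 'a" and dep :: "'a \<Rightarrow> nat" where
    "par r = r" "dep r = 0" "\<And>v. v \<in> pverts T \<Longrightarrow> par v \<in> pverts T"
    "\<And>v. v \<in> pverts T \<Longrightarrow> v \<noteq> r \<Longrightarrow> dep v = Suc (dep (par v))"
    "\<And>u v. (u, v) \<in> parcs T \<longleftrightarrow> u \<in> pverts T - {r} \<and> v = par u \<or> v \<in> pverts T - {r} \<and> u = par v"
    by (rule rooting[OF sym irr sub r conn acyclic]) auto
  then show thesis using r pair_finite_verts by (intro that[of par dep]) (unfold_locales, auto)
qed

lemma halin_graph_B1:
  assumes "halin_graph H" shows "\<exists>P. vpg_representation 1 H P"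
proof -
  obtain T C where T: "tree_graph T" and C: "cycle_graph C" and CT: "pverts C = leaves T"
    and H: "pverts H = pverts T \<union> pverts C" "parcs H = parcs T \<union> parcs C" and "planar_graph H"
    using assms unfolding halin_graph_def by blast
  then obtain f \<gamma> where d: "plane_drawing H f \<gamma>" unfolding planar_graph_def by blast
  obtain vs where vs: "distinct vs" "3 \<le> length vs" "set vs = pverts C"
    "\<And>x y. (x, y) \<in> parcs C \<longleftrightarrow> (\<exists>i<length vs. {x, y} = {vs ! i, vs ! (Suc i mod length vs)})"
    using cycle_graph_list[OF C] by metis
  let ?V = "pverts T"
  have vs_leaves: "set vs = leaves T" using vs(3) CT by simp
  then have vs_V: "set vs \<subseteq> ?V" by (auto simp: leaves_def)
  have HV: "pverts H = ?V" using H(1) vs(3) vs_V by auto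
  define r where "r = vs ! 0"
  have r_leaf: "r \<in> set vs" using vs(2) by (auto simp: r_def intro: nth_mem)
  then have r_in: "r \<in> ?V" using vs_V by auto
  obtain par dep where rt: "rooted_tree ?V par dep r"
    and arc: "\<And>u v. (u, v) \<in> parcs T \<longleftrightarrow> u \<in> ?V - {r} \<and> v = par u \<or> v \<in> ?V - {r} \<and> u = par v"
    by (rule tree_graph_rooting[OF T r_in]) blast
  interpret rooted_tree ?V par dep r by (rule rt)
  have leaf_iff: "x \<in> set vs \<longleftrightarrow> x \<in> ?V \<and> card {w. (x, w) \<in> parcs T} = 1" for x
    using vs_leaves by (auto simp: leaves_def out_degree_card)
  have leaf_unique: "y = z" if "x \<in> set vs" "(x, y) \<in> parcs T" "(x, z) \<in> parcs T" for x y z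
  proof -
    have "card {w. (x, w) \<in> parcs T} = 1" using that(1) leaf_iff by blast
    then obtain a where "{w. (x, w) \<in> parcs T} = {a}" by (rule card_1_singletonE)
    moreover have "y \<in> {w. (x, w) \<in> parcs T}" "z \<in> {w. (x, w) \<in> parcs T}" using that(2,3) by simp_all
    ultimately show ?thesis by simp
  qed
  have "card {w. (r, w) \<in> parcs T} = 1" using leaf_iff r_leaf by blast
  then obtain t where t: "(r, t) \<in> parcs T" by (rule card_1_singletonE) blast
  then have t': "t \<in> ?V" "t \<noteq> r" "par t = r" using arc by auto
  interpret leafy_tree ?V par dep r vs "length vs - 1" t
  proof unfold_locales
    show "par v = r" if v: "v \<in> ?V" "v \<noteq> r" "par v \<in> set vs" for v
    proof (rule ccontr)
      \<comment> \<open>The leaf \<open>par v\<close> would have a child and a parent as neighbours,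
        and these differ because their depths differ by two.\<close>
      assume ne: "par v \<noteq> r"
      have "(par v, v) \<in> parcs T" "(par v, par (par v)) \<in> parcs T"
        using arc v(1,2) ne par_in by auto
      then have "v = par (par v)" using leaf_unique v(3) by blast
      moreover have "dep v = Suc (Suc (dep (par (par v))))"
        using dep_par[OF v(1,2)] dep_par[OF par_in[OF v(1)] ne] by simp
      ultimately show False by simp
    qed
    show "\<exists>u\<in>?V - {r}. par u = v" if v: "v \<in> ?V" "v \<notin> set vs" for v
    proof (rule ccontr)
      assume no: "\<not> ?thesis"
      have "v \<noteq> r" using v(2) r_leaf by auto
      then have "{w. (v, w) \<in> parcs T} = {par v}" using arc v(1) no by auto
      then show False using v leaf_iff[of v] by simp
    qed
    show "par v = r \<longleftrightarrow> v = t" if v: "v \<in> ?V" "v \<noteq> r" for v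
    proof
      assume "par v = r"
      then have "(r, v) \<in> parcs T" using arc v by auto
      then show "v = t" using leaf_unique[OF r_leaf] t by blast
    qed (use t' in simp)
  qed (use vs vs_V t' in \<open>auto simp: r_def\<close>)
  define E where "E = {{v, par v} | v. v \<in> ?V - {r}} \<union>
      {{vs ! i, vs ! (Suc i mod length vs)} | i. i < length vs}"
  have E_sub: "E \<subseteq> edges H"
  proof
    fix e assume "e \<in> E"
    then consider v where "e = {v, par v}" "v \<in> ?V - {r}"
      | i where "e = {vs ! i, vs ! (Suc i mod length vs)}" "i < length vs" unfolding E_def by blast
    then show "e \<in> edges H"
    proof cases
      case 1
      then have "(v, par v) \<in> parcs H" using arc H(2) by auto
      then show ?thesis using 1(1) unfolding edges_def by blast
    next
      case 2
      then have "(vs ! i, vs ! (Suc i mod length vs)) \<in> parcs H" using vs(4) H(2) by blast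
      then show ?thesis using 2(1) unfolding edges_def by blast
    qed
  qed
  have edges_V: "e \<subseteq> ?V" if "e \<in> E" for e
  proof -
    have "Suc i mod length vs < length vs" for i using vs(2) by (intro mod_less_divisor) linarith
    then have "{vs ! i, vs ! (Suc i mod length vs)} \<subseteq> set vs" if "i < length vs" for i
      using that by simp
    then show ?thesis using that vs_V par_in unfolding E_def by blast
  qed
  have plane: "plane_edges ?V E f \<gamma>"
  proof unfold_locales
    show "inj_on f ?V" using d HV by (simp add: plane_drawing_def)
    show "e \<subseteq> ?V" if "e \<in> E" for e using edges_V that .
    show "arc (\<gamma> e) \<and> {pathstart (\<gamma> e), pathfinish (\<gamma> e)} = f ` e \<and>
        path_image (\<gamma> e) \<inter> f ` ?V = f ` e" if "e \<in> E" for e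
      using d subsetD[OF E_sub that] HV by (simp add: plane_drawing_def)
    show "path_image (\<gamma> e) \<inter> path_image (\<gamma> e') \<subseteq> f ` (e \<inter> e')" if "e \<in> E" "e' \<in> E" "e \<noteq> e'" for e e'
      using d subsetD[OF E_sub that(1)] subsetD[OF E_sub that(2)] that(3)
      unfolding plane_drawing_def by blast
  qed
  interpret plane_halin ?V par dep r vs "length vs - 1" t f \<gamma>
    using leafy_tree_axioms plane unfolding E_def plane_halin_def by blast
  interpret halin_tree ?V par dep r vs "length vs - 1" t
    by unfold_locales (rule contiguous_leaves)
  have tree_adj_iff: "(u, v) \<in> parcs T \<longleftrightarrow> tree_adj u v" if "u \<in> ?V" "v \<in> ?V" for u v
    using that arc by (auto simp: tree_adj_def)
  have "vpg_representation 1 H curve"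
    unfolding vpg_representation_def HV
  proof (intro conjI ballI impI)
    show "bend_path 1 (curve u)" if "u \<in> ?V" for u by (rule bend_curve[OF that])
    fix u v assume uv: "u \<in> ?V" "v \<in> ?V" "u \<noteq> v"
    have "(u, v) \<in> parcs H \<longleftrightarrow> tree_adj u v \<or> cyc_adj u v"
      unfolding H(2) Un_iff tree_adj_iff[OF uv(1,2)] vs(4) cyc_adj_def ..
    then show "(u, v) \<in> parcs H \<longleftrightarrow> path_image (curve u) \<inter> path_image (curve v) \<noteq> {}"
      using curve_meets_iff[OF uv] by simp
  qed
  then show ?thesis by blast
qed

section \<open>The wheel with four spokes\<close>

text \<open>A box with one side collapsed covers horizontal and vertical segments alike, and boxes
  meet exactly if both of their projections do.\<close>

lemma bend_path_0_box:
  assumes "bend_path 0 g"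
  obtains a b c d where "a \<le> b" "c \<le> d" "a = b \<or> c = d"
    "path_image g = {z. a \<le> Re z \<and> Re z \<le> b \<and> c \<le> Im z \<and> Im z \<le> d}"
proof -
  obtain ps where ps: "length ps = 2" "g = polyline ps"
    and hv: "horizontal (ps ! 0) (ps ! 1) \<or> vertical (ps ! 0) (ps ! 1)"
    using assms by (auto simp: bend_path_def numeral_2_eq_2)
  obtain p q where pq: "ps = [p, q]" using ps(1) by (auto simp: numeral_2_eq_2 length_Suc_conv)
  have img: "path_image g = closed_segment p q" using ps pq by simp
  have ivl: "closed_segment x y = {min x y..max x y}" for x y :: real
    by (simp add: closed_segment_eq_real_ivl)
  show thesis
  proof (cases "Im p = Im q")
    case True
    have "path_image g = {z. min (Re p) (Re q) \<le> Re z \<and> Re z \<le> max (Re p) (Re q) \<and>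
        Im p \<le> Im z \<and> Im z \<le> Im p}"
      unfolding img closed_segment_same_Im[OF True] ivl atLeastAtMost_iff by (intro Collect_cong) linarith
    then show ?thesis by (rule that[rotated 3]) simp_all
  next
    case False
    then have same: "Re p = Re q" using hv pq by (auto simp: horizontal_def vertical_def)
    have "path_image g = {z. Re p \<le> Re z \<and> Re z \<le> Re p \<and>
        min (Im p) (Im q) \<le> Im z \<and> Im z \<le> max (Im p) (Im q)}"
      unfolding img closed_segment_same_Re[OF same] ivl atLeastAtMost_iff by (intro Collect_cong) linarith
    then show ?thesis by (rule that[rotated 3]) simp_all
  qed
qed

lemma box_meets_iff:
  fixes a b c d :: real
  assumes "a \<le> b" "c \<le> d" "a' \<le> b'" "c' \<le> d'"
  shows "{z. a \<le> Re z \<and> Re z \<le> b \<and> c \<le> Im z \<and> Im z \<le> d} \<inter>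
      {z. a' \<le> Re z \<and> Re z \<le> b' \<and> c' \<le> Im z \<and> Im z \<le> d'} \<noteq> {} \<longleftrightarrow>
    a \<le> b' \<and> a' \<le> b \<and> c \<le> d' \<and> c' \<le> d" (is "?L \<longleftrightarrow> ?R")
proof
  assume ?R
  then have "Complex (max a a') (max c c') \<in> {z. a \<le> Re z \<and> Re z \<le> b \<and> c \<le> Im z \<and> Im z \<le> d} \<inter>
      {z. a' \<le> Re z \<and> Re z \<le> b' \<and> c' \<le> Im z \<and> Im z \<le> d'}"
    using assms by auto
  then show ?L by blast
qed auto

text \<open>If the intervals 1 and 3 are disjoint, then 2 and 4 both bridge the gap between them and
  therefore meet.\<close>

lemma no_interval_4_cycle:
  fixes a1 a2 a3 a4 b1 b2 b3 b4 :: real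
  assumes "a1 \<le> b2" "a2 \<le> b1" "a2 \<le> b3" "a3 \<le> b2" "a3 \<le> b4" "a4 \<le> b3" "a4 \<le> b1" "a1 \<le> b4"
  shows "a1 \<le> b3 \<and> a3 \<le> b1 \<or> a2 \<le> b4 \<and> a4 \<le> b2"
  using assms by linarith

definition spokes :: "nat rel" where
  "spokes = {(0, 1), (0, 2), (0, 3), (0, 4), (1, 0), (2, 0), (3, 0), (4, 0)}"

definition rim :: "nat rel" where
  "rim = {(1, 2), (2, 3), (3, 4), (4, 1), (2, 1), (3, 2), (4, 3), (1, 4)}"

definition star4 :: "nat pair_pre_digraph" where
  "star4 = \<lparr>pverts = {0, 1, 2, 3, 4}, parcs = spokes\<rparr>"

definition cycle4 :: "nat pair_pre_digraph" where
  "cycle4 = \<lparr>pverts = {1, 2, 3, 4}, parcs = rim\<rparr>"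

definition wheel4 :: "nat pair_pre_digraph" where
  "wheel4 = \<lparr>pverts = {0, 1, 2, 3, 4}, parcs = spokes \<union> rim\<rparr>"

text \<open>The hub is constant in one coordinate. All four rim segments take this value, so in that
  projection they meet pairwise, and the other projection alone decides their adjacency. It would
  represent a chordless 4-cycle by intervals.\<close>

lemma wheel4_not_B0: "\<not> vpg_representation 0 wheel4 P"
proof
  assume P: "vpg_representation 0 wheel4 P"
  let ?V = "pverts wheel4"
  define box where "box u a b c d \<longleftrightarrow> a \<le> b \<and> c \<le> d \<and> (a = b \<or> c = d) \<and>
      path_image (P u) = {z. a \<le> Re z \<and> Re z \<le> b \<and> c \<le> Im z \<and> Im z \<le> d}" for u a b c d
  have "\<exists>a b c d. box u a b c d" if "u \<in> ?V" for u
  proof -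
    have "bend_path 0 (P u)" using P that unfolding vpg_representation_def by blast
    then show ?thesis unfolding box_def by (rule bend_path_0_box) (intro exI conjI)
  qed
  then obtain a b c d where box: "\<And>u. u \<in> ?V \<Longrightarrow> box u (a u) (b u) (c u) (d u)"
    by metis
  have adj: "(u, v) \<in> parcs wheel4 \<longleftrightarrow> a u \<le> b v \<and> a v \<le> b u \<and> c u \<le> d v \<and> c v \<le> d u"
    if "u \<in> ?V" "v \<in> ?V" "u \<noteq> v" for u v
  proof -
    have "(u, v) \<in> parcs wheel4 \<longleftrightarrow> path_image (P u) \<inter> path_image (P v) \<noteq> {}"
      using P that unfolding vpg_representation_def by blast
    also have "\<dots> \<longleftrightarrow> a u \<le> b v \<and> a v \<le> b u \<and> c u \<le> d v \<and> c v \<le> d u"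
      using box[OF that(1)] box[OF that(2)] unfolding box_def by (simp only: box_meets_iff)
    finally show ?thesis .
  qed
  have hub: "a 0 \<le> b v" "a v \<le> b 0" "c 0 \<le> d v" "c v \<le> d 0" if "v \<in> {1, 2, 3, 4}" for v
    using adj[of 0 v] that by (auto simp: wheel4_def spokes_def rim_def)
  have r: "a 1 \<le> b 2 \<and> a 2 \<le> b 1 \<and> c 1 \<le> d 2 \<and> c 2 \<le> d 1"
      "a 2 \<le> b 3 \<and> a 3 \<le> b 2 \<and> c 2 \<le> d 3 \<and> c 3 \<le> d 2"
      "a 3 \<le> b 4 \<and> a 4 \<le> b 3 \<and> c 3 \<le> d 4 \<and> c 4 \<le> d 3"
      "a 4 \<le> b 1 \<and> a 1 \<le> b 4 \<and> c 4 \<le> d 1 \<and> c 1 \<le> d 4"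
      "\<not> (a 1 \<le> b 3 \<and> a 3 \<le> b 1 \<and> c 1 \<le> d 3 \<and> c 3 \<le> d 1)"
      "\<not> (a 2 \<le> b 4 \<and> a 4 \<le> b 2 \<and> c 2 \<le> d 4 \<and> c 4 \<le> d 2)"
    using adj[of 1 2] adj[of 2 3] adj[of 3 4] adj[of 4 1] adj[of 1 3] adj[of 2 4]
    by (auto simp: wheel4_def spokes_def rim_def)
  have "a 0 = b 0 \<or> c 0 = d 0" using box[of 0] by (simp add: wheel4_def box_def)
  then show False
  proof
    assume "a 0 = b 0"
    then have "a u \<le> b v" if "u \<in> {1, 2, 3, 4}" "v \<in> {1, 2, 3, 4}" for u v
      using hub(2)[OF that(1)] hub(1)[OF that(2)] by linarith
    then have "a 1 \<le> b 3 \<and> a 3 \<le> b 1" "a 2 \<le> b 4 \<and> a 4 \<le> b 2" by simp_all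
    then show False using r no_interval_4_cycle[of "c 1" "d 2" "c 2" "d 1" "d 3" "c 3" "d 4" "c 4"] by blast
  next
    assume "c 0 = d 0"
    then have "c u \<le> d v" if "u \<in> {1, 2, 3, 4}" "v \<in> {1, 2, 3, 4}" for u v
      using hub(4)[OF that(1)] hub(3)[OF that(2)] by linarith
    then have "c 1 \<le> d 3 \<and> c 3 \<le> d 1" "c 2 \<le> d 4 \<and> c 4 \<le> d 2" by simp_all
    then show False using r no_interval_4_cycle[of "a 1" "b 2" "a 2" "b 1" "b 3" "a 3" "b 4" "a 4"] by blast
  qed
qed

section \<open>A straight-line drawing of the wheel\<close>

definition pos4 :: "nat \<Rightarrow> complex" where
  "pos4 v = (if v = 1 then 1 else if v = 2 then \<i> else if v = 3 then - 1 else if v = 4 then - \<i> else 0)"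

text \<open>
  The piecewise linear coordinates of a point with respect to the four triangles of the drawing:
  a point of an edge has coordinate 0 at every other vertex.
\<close>

definition coord4 :: "nat \<Rightarrow> complex \<Rightarrow> real" where
  "coord4 v z = (if v = 1 then max 0 (Re z) else if v = 2 then max 0 (Im z)
     else if v = 3 then max 0 (- Re z) else if v = 4 then max 0 (- Im z)
     else 1 - \<bar>Re z\<bar> - \<bar>Im z\<bar>)"

text \<open>One orientation per edge, the smaller end first, so that \<open>Min\<close> and
  \<open>Max\<close> of an edge recover its ends in this order.\<close>

definition arcs4 :: "nat rel" where
  "arcs4 = {(0, 1), (0, 2), (0, 3), (0, 4), (1, 2), (2, 3), (3, 4), (1, 4)}"

lemma edges_wheel4: "edges wheel4 = {{u, v} | u v. (u, v) \<in> arcs4}"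
proof -
  have "(u, v) \<in> spokes \<union> rim \<longleftrightarrow> (u, v) \<in> arcs4 \<or> (v, u) \<in> arcs4" for u v
    unfolding spokes_def rim_def arcs4_def by auto
  then have "edges wheel4 = {{u, v} | u v. (u, v) \<in> arcs4 \<or> (v, u) \<in> arcs4}"
    unfolding edges_def wheel4_def by simp
  also have "\<dots> = {{u, v} | u v. (u, v) \<in> arcs4}"
    using insert_commute by blast
  finally show ?thesis .
qed

lemma max_0_eq_0_iff: "max 0 x = 0 \<longleftrightarrow> x \<le> (0 :: real)"
  by linarith

lemma coord4_segment:
  assumes "(u, v) \<in> arcs4" "z \<in> closed_segment (pos4 u) (pos4 v)" "w \<le> 4" "w \<notin> {u, v}"
  shows "coord4 w z = 0"
proof -
  obtain s where s: "0 \<le> s" "s \<le> 1" "z = (1 - s) *\<^sub>R pos4 u + s *\<^sub>R pos4 v"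
    using assms(2) by (auto simp: in_segment)
  have w: "w = 0 \<or> w = 1 \<or> w = 2 \<or> w = 3 \<or> w = 4" using assms(3) by auto
  consider "u = 0" "v = 1" | "u = 0" "v = 2" | "u = 0" "v = 3" | "u = 0" "v = 4"
    | "u = 1" "v = 2" | "u = 2" "v = 3" | "u = 3" "v = 4" | "u = 1" "v = 4"
    using assms(1) unfolding arcs4_def by blast
  then show ?thesis
    by cases (use w assms(4) s in \<open>auto simp: coord4_def pos4_def max_0_eq_0_iff\<close>)
qed

text \<open>The five coordinates sum to 1. So they cannot all vanish, and a single nonzero one
  equals 1, which pins down the point.\<close>

lemma coord4_unique:
  assumes "\<And>w. w \<le> 4 \<Longrightarrow> w \<noteq> x \<Longrightarrow> coord4 w z = 0" "x \<le> 4"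
  shows "z = pos4 x"
proof -
  have "x \<in> {0, 1, 2, 3, 4}" using assms(2) by auto
  moreover have c: "x = w \<or> coord4 w z = 0" if "w \<le> 4" for w using assms(1)[OF that] by blast
  have "x = 0 \<or> coord4 0 z = 0" "x = 1 \<or> coord4 1 z = 0" "x = 2 \<or> coord4 2 z = 0"
    "x = 3 \<or> coord4 3 z = 0" "x = 4 \<or> coord4 4 z = 0" by (rule c; simp)+
  ultimately show ?thesis
    unfolding complex_eq_iff by (elim insertE emptyE) (simp_all add: coord4_def pos4_def max_0_eq_0_iff)
qed

lemma coord4_nonzero: "\<exists>w\<le>4. coord4 w z \<noteq> 0"
proof (rule ccontr)
  assume "\<not> ?thesis"
  then have "coord4 0 z = 0" "coord4 1 z = 0" "coord4 2 z = 0" "coord4 3 z = 0" "coord4 4 z = 0" by auto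
  then show False by (simp add: coord4_def max_0_eq_0_iff)
qed

lemma coord4_pos4: "x \<le> 4 \<Longrightarrow> coord4 x (pos4 x) = 1"
  by (auto simp: coord4_def pos4_def)

text \<open>At a point of two edges, a coordinate can be nonzero only for a common vertex. Different
  edges have at most one, so the point is that vertex.\<close>

lemma planar_wheel4: "planar_graph wheel4"
  unfolding planar_graph_def plane_drawing_def
proof (intro exI conjI ballI impI)
  let ?\<gamma> = "\<lambda>e. linepath (pos4 (Min e)) (pos4 (Max e))"
  have V: "x \<in> pverts wheel4 \<longleftrightarrow> x \<le> 4" for x by (auto simp: wheel4_def)
  have pos4_eq: "x = y" if "x \<le> 4" "y \<le> 4" "pos4 x = pos4 y" for x y
    using that by (auto simp: pos4_def complex_eq_iff split: if_splits)
  show "inj_on pos4 (pverts wheel4)" using pos4_eq V by (intro inj_onI) auto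
  have E: "\<exists>u v. (u, v) \<in> arcs4 \<and> e = {u, v} \<and> u < v \<and> v \<le> 4 \<and> ?\<gamma> e = linepath (pos4 u) (pos4 v)"
    if e: "e \<in> edges wheel4" for e
  proof -
    obtain u v where uv: "(u, v) \<in> arcs4" "e = {u, v}" using e unfolding edges_wheel4 by blast
    then have "u < v" "v \<le> 4" by (auto simp: arcs4_def)
    then show ?thesis using uv by (intro exI[of _ u] exI[of _ v]) auto
  qed
  have supp: "coord4 w z = 0" if "e \<in> edges wheel4" "z \<in> path_image (?\<gamma> e)" "w \<le> 4" "w \<notin> e" for e z w
    using E[OF that(1)] coord4_segment that(2-4) by (metis path_image_linepath)
  {
    fix e assume e: "e \<in> edges wheel4"
    then obtain u v where uv: "e = {u, v}" "u < v" "v \<le> 4" "?\<gamma> e = linepath (pos4 u) (pos4 v)"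
      using E by blast
    have ne: "pos4 u \<noteq> pos4 v" using pos4_eq[of u v] uv by auto
    then show "arc (?\<gamma> e)" unfolding uv(4) by (rule arc_linepath)
    show "{pathstart (?\<gamma> e), pathfinish (?\<gamma> e)} = pos4 ` e" unfolding uv(4) using uv(1) by simp
    have "x \<in> e" if "pos4 x \<in> path_image (?\<gamma> e)" "x \<le> 4" for x
      using supp[OF e that(1,2)] coord4_pos4[OF that(2)] by auto
    moreover have "pos4 u \<in> path_image (?\<gamma> e)" "pos4 v \<in> path_image (?\<gamma> e)"
      unfolding uv(4) by simp_all
    ultimately show "path_image (?\<gamma> e) \<inter> pos4 ` pverts wheel4 = pos4 ` e"
      using V uv(1-3) by auto
  }
  fix e e' assume e: "e \<in> edges wheel4" "e' \<in> edges wheel4" "e \<noteq> e'"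
  show "path_image (?\<gamma> e) \<inter> path_image (?\<gamma> e') \<subseteq> pos4 ` (e \<inter> e')"
  proof
    fix z assume z: "z \<in> path_image (?\<gamma> e) \<inter> path_image (?\<gamma> e')"
    have supp2: "w \<in> e \<inter> e'" if "w \<le> 4" "coord4 w z \<noteq> 0" for w
      using supp[of e z w] supp[of e' z w] e z that by blast
    obtain x where x: "x \<le> 4" "coord4 x z \<noteq> 0" using coord4_nonzero by blast
    obtain u v where uv: "e = {u, v}" using E[OF e(1)] by blast
    obtain u' v' where uv': "e' = {u', v'}" using E[OF e(2)] by blast
    have "w = x" if "w \<in> e \<inter> e'" for w
    proof (rule ccontr)
      assume "w \<noteq> x"
      then have "{u, v} = {w, x}" "{u', v'} = {w, x}"
        using that supp2[OF x] unfolding uv uv' by auto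
      then show False using e(3) uv uv' by simp
    qed
    then have "z = pos4 x" using supp2 coord4_unique[OF _ x(1), of z] by blast
    then show "z \<in> pos4 ` (e \<inter> e')" using supp2[OF x] by blast
  qed
qed

section \<open>The wheel as a Halin graph\<close>

lemma pair_graph_sym:
  assumes "finite V" "sym A" "irrefl A" "A \<subseteq> V \<times> V"
  shows "pair_graph \<lparr>pverts = V, parcs = A\<rparr>"
proof unfold_locales
  show "finite (parcs \<lparr>pverts = V, parcs = A\<rparr>)"
    using assms finite_subset by fastforce
  show "symmetric (with_proj \<lparr>pverts = V, parcs = A\<rparr>)" using assms by (simp add: symmetric_def)
qed (use assms in \<open>auto simp: irrefl_def\<close>)

lemma spokes_rim: "sym spokes" "irrefl spokes" "sym rim" "irrefl rim"
  by (auto simp: spokes_def rim_def sym_def irrefl_def)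

text \<open>Every arc has exactly one end at the hub, so a walk visits it at every other vertex. A
  closed walk of length 3 violates this parity, and a longer one repeats the hub.\<close>

lemma tree_star4: "tree_graph star4"
  unfolding tree_graph_def
proof (intro conjI notI)
  show "pair_graph star4"
    unfolding star4_def using spokes_rim by (intro pair_graph_sym) (auto simp: spokes_def)
  let ?S = "mk_symmetric (with_proj star4)"
  have S: "pverts ?S = {0, 1, 2, 3, 4}" "parcs ?S = spokes"
    by (auto simp: mk_symmetric_def star4_def spokes_def)
  have "(u, v) \<in> rtrancl_on {0, 1, 2, 3, 4} spokes" if "u \<in> {0, 1, 2, 3, 4}" "v \<in> {0, 1, 2, 3, 4}" for u v
  proof -
    have "(u, 0) \<in> rtrancl_on {0, 1, 2, 3, 4} spokes"
      using that rtrancl_on_into_rtrancl_on[OF rtrancl_on_refl[OF that(1)], of 0 spokes]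
      by (cases "u = 0") (auto simp: spokes_def)
    then show ?thesis
      using that rtrancl_on_into_rtrancl_on[of u 0 "{0, 1, 2, 3, 4}" spokes v]
      by (cases "v = 0") (auto simp: spokes_def)
  qed
  then show "Digraph_Component.connected (with_proj star4)"
    unfolding Digraph_Component.connected_def strongly_connected_def reachable_def using S by simp
  assume "\<exists>p. pre_digraph.cycle (with_proj star4) p \<and> 3 \<le> length p"
  then obtain p u where p: "pcas u p u" "set p \<subseteq> spokes" "distinct (tl (pawalk_verts u p))" "3 \<le> length p"
    by (auto simp: pre_digraph.cycle_def pre_digraph.awalk_def cas_with_proj_eq
        awalk_verts_with_proj_eq star4_def)
  then obtain e1 e2 e3 q where q: "p = e1 # e2 # e3 # q"
    by (auto simp: numeral_3_eq_3 Suc_le_length_iff)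
  have hub: "(fst e = 0) \<noteq> (snd e = 0)" if "e \<in> spokes" for e
    using that by (auto simp: spokes_def)
  have e: "snd e1 = fst e2" "snd e2 = fst e3" "e1 \<in> spokes" "e2 \<in> spokes" "e3 \<in> spokes" "fst e1 = u"
    using p(1,2) q by auto
  have dist: "distinct (fst e2 # fst e3 # pawalk_verts (snd e3) q)" using p(3) q by simp
  show False
  proof (cases q)
    case Nil
    then show ?thesis using p(1) q hub[OF e(3)] hub[OF e(4)] hub[OF e(5)] e by auto
  next
    case (Cons e4 q')
    then have e4: "fst e4 = snd e3" "e4 \<in> spokes" using p(1,2) q by auto
    show ?thesis
    proof (cases "u = 0")
      case True
      then have "fst e3 = 0" "snd e4 = 0"
        using hub[OF e(3)] hub[OF e(4)] hub[OF e(5)] hub[OF e4(2)] e e4 by auto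
      moreover have "snd e4 \<in> set (pawalk_verts (snd e4) q')" by (cases q') (use p(1) q Cons in auto)
      ultimately show ?thesis using dist Cons by auto
    next
      case False
      then have "fst e2 = 0" "fst e4 = 0"
        using hub[OF e(3)] hub[OF e(4)] hub[OF e(5)] e e4 by auto
      then show ?thesis using dist Cons by auto
    qed
  qed
qed

lemma cycle_cycle4: "cycle_graph cycle4"
  unfolding cycle_graph_def
proof (intro conjI exI)
  let ?p = "[(1, 2), (2, 3), (3, 4), (4, 1)] :: (nat \<times> nat) list"
  show "pair_graph cycle4"
    unfolding cycle4_def using spokes_rim by (intro pair_graph_sym) (auto simp: rim_def)
  show "pre_digraph.cycle (with_proj cycle4) ?p"
    by (auto simp: pre_digraph.cycle_def pre_digraph.awalk_def cas_with_proj_eq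
        awalk_verts_with_proj_eq cycle4_def rim_def)
qed (auto simp: cycle4_def rim_def)

lemma leaves_star4: "leaves star4 = {1, 2, 3, 4}"
proof -
  have "{w. (0, w) \<in> spokes} = {1, 2, 3, 4}" "{w. (1, w) \<in> spokes} = {0}" "{w. (2, w) \<in> spokes} = {0}"
    "{w. (3, w) \<in> spokes} = {0}" "{w. (4, w) \<in> spokes} = {0}"
    by (auto simp: spokes_def)
  then have "card {w. (v, w) \<in> spokes} = (if v = 0 then 4 else 1)" if "v \<in> {0, 1, 2, 3, 4}" for v
    using that by (elim insertE emptyE) (simp_all del: One_nat_def)
  then have "{v \<in> {0, 1, 2, 3, 4}. card {w. (v, w) \<in> spokes} = 1} = {v \<in> {0, 1, 2, 3, 4}. v \<noteq> 0}"
    by (intro Collect_cong conj_cong refl) simp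
  also have "\<dots> = {1, 2, 3, 4}" by auto
  finally show ?thesis unfolding leaves_def out_degree_card star4_def by simp
qed

lemma halin_wheel4: "halin_graph wheel4"
  unfolding halin_graph_def
proof (intro conjI exI ballI)
  show "pair_graph wheel4"
    unfolding wheel4_def using spokes_rim
    by (intro pair_graph_sym sym_Un) (auto simp: spokes_def rim_def irrefl_def)
  show "out_degree (with_proj wheel4) v \<noteq> 2" if "v \<in> pverts wheel4" for v
  proof -
    have "{w. (0, w) \<in> spokes \<union> rim} = {1, 2, 3, 4}" "{w. (1, w) \<in> spokes \<union> rim} = {0, 2, 4}"
      "{w. (2, w) \<in> spokes \<union> rim} = {0, 1, 3}" "{w. (3, w) \<in> spokes \<union> rim} = {0, 2, 4}"
      "{w. (4, w) \<in> spokes \<union> rim} = {0, 1, 3}"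
      by (auto simp: spokes_def rim_def)
    then show ?thesis using that unfolding out_degree_card wheel4_def
      by (simp del: One_nat_def, elim disjE) (simp_all del: One_nat_def)
  qed
  show "planar_graph wheel4" by (rule planar_wheel4)
  show "tree_graph star4" by (rule tree_star4)
  show "cycle_graph cycle4" by (rule cycle_cycle4)
  show "pverts cycle4 = leaves star4" unfolding leaves_star4 by (simp add: cycle4_def)
qed (auto simp: cycle4_def star4_def wheel4_def)

theorem corollary1:
  shows "(\<forall>H :: 'a pair_pre_digraph. halin_graph H \<longrightarrow> vpg_bend_number H \<le> 1) \<and>
    (\<exists>H :: nat pair_pre_digraph. halin_graph H \<and> vpg_bend_number H = 1)"
proof -
  \<comment> \<open>The goal fixes \<open>'a\<close>; a fresh type variable makes this fact apply
    both to arbitrary graphs and to the wheel on \<open>nat\<close>.\<close>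
  have upper: "vpg_bend_number H \<le> 1" if "halin_graph H" for H :: "'b pair_pre_digraph"
    unfolding vpg_bend_number_def one_enat_def
    by (rule Inf_lower) (use halin_graph_B1[OF that] in blast)
  have "1 \<le> vpg_bend_number wheel4"
    unfolding vpg_bend_number_def
  proof (rule Inf_greatest)
    fix x assume "x \<in> {enat k | k. \<exists>P. vpg_representation k wheel4 P}"
    then obtain k P where k: "x = enat k" "vpg_representation k wheel4 P" by blast
    then have "k \<noteq> 0" using wheel4_not_B0 by metis
    then show "1 \<le> x" by (simp add: k(1) one_enat_def)
  qed
  then have "vpg_bend_number wheel4 = 1" using upper[OF halin_wheel4] by (rule antisym[rotated])
  then show ?thesis using upper halin_wheel4 by blast
qed

end
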